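(* Let $(\mathcal C,\otimes,I,\gamma)$ be a symmetric monoidal category and $(\mathcal T,\eta,\mu,\tau)$ a centralisable strong monad on it; for each object $X$ let $(\mathcal ZX,\iota_X)$ be a terminal central cone of $\mathcal T$ at $X$, and equip $\mathcal Z$ with a commutative strong monad structure such that $\iota:\mathcal Z\Rightarrow\mathcal T$ is a monomorphism of strong monads (such a structure exists). Then the canonical embedding $\mathcal I:\mathcal C_{\mathcal Z}\to\mathcal C_{\mathcal T}$, given by $\mathcal I(X)=X$ and $\mathcal I(f:X\to\mathcal ZY)=\iota_Y\circ f$, corestricts to an isomorphism of categories $\mathcal C_{\mathcal Z}\cong Z(\mathcal C_{\mathcal T})$.
   Context: Right strength: $\tau'_{X,Y}=\mathcal T(\gamma_{Y,X})\circ\tau_{Y,X}\circ\gamma_{\mathcal TX,Y}$. A central cone of $\mathcal T$ at $X$ is a pair $(Z,\iota)$ with $\iota:Z\to\mathcal TX$ such that for every object $Y$, $\mu_{X\otimes Y}\circ\mathcal T\tau'_{X,Y}\circ\tau_{\mathcal TX,Y}\circ(\iota\otimes\mathrm{id}_{\mathcal TY})=\mu_{X\otimes Y}\circ\mathcal T\tau_{X,Y}\circ\tau'_{X,\mathcal TY}\circ(\iota\otimes\mathrm{id}_{\mathcal TY})$; a terminal central cone at $X$ is a terminal object of the category of central cones at $X$ (morphisms $\varphi$ with $\iota\circ\varphi=\iota'$); $\mathcal T$ is centralisable if terminal central cones exist at all objects. Kleisli category $\mathcal C_{\mathcal T}$: morphisms $X\to Y$ are morphisms $X\to\mathcal TY$,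 composition $g\odot f=\mu\circ\mathcal Tg\circ f$, identities $\eta$. For $f:X\to\mathcal TY$ and an object $W$: $f\otimes_l W=\tau'_{Y,W}\circ(f\otimes W)$, $W\otimes_r f=\tau_{W,Y}\circ(W\otimes f)$. A Kleisli morphism $f:X\to\mathcal TY$ is central if for all $f':X'\to\mathcal TY'$, $(Y\otimes_r f')\odot(f\otimes_l X')=(f\otimes_l Y')\odot(X\otimes_r f')$; $Z(\mathcal C_{\mathcal T})$ is the subcategory of $\mathcal C_{\mathcal T}$ with all objects and the central morphisms. Morphism of strong monads: natural $\iota$ with $\iota\circ\eta^{\mathcal Z}=\eta^{\mathcal T}$, $\iota\circ\mu^{\mathcal Z}=\mu^{\mathcal T}\circ\mathcal T\iota\circ\iota_{\mathcal Z}$, $\iota_{X\otimes Y}\circ\tau^{\mathcal Z}_{X,Y}=\tau^{\mathcal T}_{X,Y}\circ(X\otimes\iota_Y)$. *)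

theory Defs
  imports Main
begin

section \<open>Categories and functors\<close>

record ('o, 'a) cat =
  Obj :: "'o set"
  Arr :: "'a set"
  Dom :: "'a \<Rightarrow> 'o"
  Cod :: "'a \<Rightarrow> 'o"
  Id :: "'o \<Rightarrow> 'a"
  Comp :: "'a \<Rightarrow> 'a \<Rightarrow> 'a" (infixr "\<cdot>\<index>" 55)

definition hom :: "('o, 'a, 'm) cat_scheme \<Rightarrow> 'o \<Rightarrow> 'o \<Rightarrow> 'a set" where
  "hom C X Y = {f \<in> Arr C. Dom C f = X \<and> Cod C f = Y}"

locale category =
  fixes C :: "('o, 'a, 'm) cat_scheme" (structure)
  assumes Dom_Obj: "f \<in> Arr C \<Longrightarrow> Dom C f \<in> Obj C"
    and Cod_Obj: "f \<in> Arr C \<Longrightarrow> Cod C f \<in> Obj C"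
    and Id_hom: "X \<in> Obj C \<Longrightarrow> Id C X \<in> hom C X X"
    and Comp_hom: "\<lbrakk>f \<in> hom C X Y; g \<in> hom C Y Z\<rbrakk> \<Longrightarrow> g \<cdot> f \<in> hom C X Z"
    and Comp_Id: "f \<in> hom C X Y \<Longrightarrow> f \<cdot> Id C X = f"
    and Id_Comp: "f \<in> hom C X Y \<Longrightarrow> Id C Y \<cdot> f = f"
    and Comp_assoc: "\<lbrakk>f \<in> hom C W X; g \<in> hom C X Y; h \<in> hom C Y Z\<rbrakk>
      \<Longrightarrow> (h \<cdot> g) \<cdot> f = h \<cdot> (g \<cdot> f)"

definition iso_arrow :: "('o, 'a, 'm) cat_scheme \<Rightarrow> 'o \<Rightarrow> 'o \<Rightarrow> 'a \<Rightarrow> bool" where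
  "iso_arrow C X Y f \<longleftrightarrow> f \<in> hom C X Y \<and>
     (\<exists>g \<in> hom C Y X. g \<cdot>\<^bsub>C\<^esub> f = Id C X \<and> f \<cdot>\<^bsub>C\<^esub> g = Id C Y)"

definition terminal_object :: "('o, 'a, 'm) cat_scheme \<Rightarrow> 'o \<Rightarrow> bool" where
  "terminal_object C t \<longleftrightarrow> t \<in> Obj C \<and> (\<forall>X \<in> Obj C. \<exists>!f. f \<in> hom C X t)"

definition subcategory :: "('o, 'a, 'm) cat_scheme \<Rightarrow> ('o, 'a, 'n) cat_scheme \<Rightarrow> bool" where
  "subcategory S C \<longleftrightarrow> category S \<and> category C \<and> Obj S \<subseteq> Obj C \<and> Arr S \<subseteq> Arr C \<and>
     (\<forall>f \<in> Arr S. Dom S f = Dom C f \<and> Cod S f = Cod C f) \<and>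
     (\<forall>X \<in> Obj S. Id S X = Id C X) \<and>
     (\<forall>X Y Z f g. f \<in> hom S X Y \<and> g \<in> hom S Y Z \<longrightarrow> g \<cdot>\<^bsub>S\<^esub> f = g \<cdot>\<^bsub>C\<^esub> f)"

record ('o, 'a, 'p, 'b) func =
  OMap :: "'o \<Rightarrow> 'p"
  AMap :: "'a \<Rightarrow> 'b"

locale cat_functor = A: category A + B: category B
  for A :: "('o, 'a, 'm) cat_scheme"
    and B :: "('p, 'b, 'n) cat_scheme"
    and F :: "('o, 'a, 'p, 'b, 'k) func_scheme" +
  assumes OMap_Obj: "X \<in> Obj A \<Longrightarrow> OMap F X \<in> Obj B"
    and AMap_hom: "f \<in> hom A X Y \<Longrightarrow> AMap F f \<in> hom B (OMap F X) (OMap F Y)"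
    and AMap_Id: "X \<in> Obj A \<Longrightarrow> AMap F (Id A X) = Id B (OMap F X)"
    and AMap_Comp: "\<lbrakk>f \<in> hom A X Y; g \<in> hom A Y Z\<rbrakk>
      \<Longrightarrow> AMap F (g \<cdot>\<^bsub>A\<^esub> f) = AMap F g \<cdot>\<^bsub>B\<^esub> AMap F f"

definition isomorphism_of_categories ::
  "('o, 'a, 'm) cat_scheme \<Rightarrow> ('p, 'b, 'n) cat_scheme \<Rightarrow> ('o, 'a, 'p, 'b) func \<Rightarrow> bool" where
  "isomorphism_of_categories A B F \<longleftrightarrow> cat_functor A B F \<and>
     (\<exists>G :: ('p, 'b, 'o, 'a) func. cat_functor B A G \<and>
       (\<forall>X \<in> Obj A. OMap G (OMap F X) = X) \<and> (\<forall>f \<in> Arr A. AMap G (AMap F f) = f) \<and>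
       (\<forall>Y \<in> Obj B. OMap F (OMap G Y) = Y) \<and> (\<forall>g \<in> Arr B. AMap F (AMap G g) = g))"

definition corestricts_to_isomorphism ::
  "('o, 'a, 'm) cat_scheme \<Rightarrow> ('p, 'b, 'n) cat_scheme \<Rightarrow> ('p, 'b, 'l) cat_scheme \<Rightarrow>
   ('o, 'a, 'p, 'b) func \<Rightarrow> bool" where
  "corestricts_to_isomorphism A B S F \<longleftrightarrow>
     cat_functor A B F \<and> subcategory S B \<and> isomorphism_of_categories A S F"

section \<open>Symmetric monoidal categories\<close>

record ('o, 'a) moncat = "('o, 'a) cat" +
  tensor_obj :: "'o \<Rightarrow> 'o \<Rightarrow> 'o" (infixr "\<otimes>\<index>" 70)
  tensor_arr :: "'a \<Rightarrow> 'a \<Rightarrow> 'a" (infixr "\<boxtimes>\<index>" 70)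
  Unit :: "'o"
  assoc :: "'o \<Rightarrow> 'o \<Rightarrow> 'o \<Rightarrow> 'a"
  lunit :: "'o \<Rightarrow> 'a"
  runit :: "'o \<Rightarrow> 'a"

locale monoidal_category = category C for C :: "('o, 'a, 'm) moncat_scheme" (structure) +
  assumes tensor_Obj: "\<lbrakk>X \<in> Obj C; Y \<in> Obj C\<rbrakk> \<Longrightarrow> X \<otimes> Y \<in> Obj C"
    and tensor_hom: "\<lbrakk>f \<in> hom C X X'; g \<in> hom C Y Y'\<rbrakk> \<Longrightarrow> f \<boxtimes> g \<in> hom C (X \<otimes> Y) (X' \<otimes> Y')"
    and tensor_Id: "\<lbrakk>X \<in> Obj C; Y \<in> Obj C\<rbrakk> \<Longrightarrow> Id C X \<boxtimes> Id C Y = Id C (X \<otimes> Y)"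
    and tensor_Comp: "\<lbrakk>f \<in> hom C X X'; f' \<in> hom C X' X''; g \<in> hom C Y Y'; g' \<in> hom C Y' Y''\<rbrakk>
      \<Longrightarrow> (f' \<cdot> f) \<boxtimes> (g' \<cdot> g) = (f' \<boxtimes> g') \<cdot> (f \<boxtimes> g)"
    and Unit_Obj: "Unit C \<in> Obj C"
    and assoc_iso: "\<lbrakk>X \<in> Obj C; Y \<in> Obj C; Z \<in> Obj C\<rbrakk>
      \<Longrightarrow> iso_arrow C ((X \<otimes> Y) \<otimes> Z) (X \<otimes> (Y \<otimes> Z)) (assoc C X Y Z)"
    and lunit_iso: "X \<in> Obj C \<Longrightarrow> iso_arrow C (Unit C \<otimes> X) X (lunit C X)"
    and runit_iso: "X \<in> Obj C \<Longrightarrow> iso_arrow C (X \<otimes> Unit C) X (runit C X)"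
    and assoc_natural: "\<lbrakk>f \<in> hom C X X'; g \<in> hom C Y Y'; h \<in> hom C Z Z'\<rbrakk>
      \<Longrightarrow> assoc C X' Y' Z' \<cdot> ((f \<boxtimes> g) \<boxtimes> h) = (f \<boxtimes> (g \<boxtimes> h)) \<cdot> assoc C X Y Z"
    and lunit_natural: "f \<in> hom C X X'
      \<Longrightarrow> lunit C X' \<cdot> (Id C (Unit C) \<boxtimes> f) = f \<cdot> lunit C X"
    and runit_natural: "f \<in> hom C X X'
      \<Longrightarrow> runit C X' \<cdot> (f \<boxtimes> Id C (Unit C)) = f \<cdot> runit C X"
    and pentagon: "\<lbrakk>W \<in> Obj C; X \<in> Obj C; Y \<in> Obj C; Z \<in> Obj C\<rbrakk>
      \<Longrightarrow> assoc C W X (Y \<otimes> Z) \<cdot> assoc C (W \<otimes> X) Y Z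
        = (Id C W \<boxtimes> assoc C X Y Z) \<cdot> assoc C W (X \<otimes> Y) Z \<cdot> (assoc C W X Y \<boxtimes> Id C Z)"
    and triangle: "\<lbrakk>X \<in> Obj C; Y \<in> Obj C\<rbrakk>
      \<Longrightarrow> (Id C X \<boxtimes> lunit C Y) \<cdot> assoc C X (Unit C) Y = runit C X \<boxtimes> Id C Y"

record ('o, 'a) symmoncat = "('o, 'a) moncat" +
  sym :: "'o \<Rightarrow> 'o \<Rightarrow> 'a"

locale symmetric_monoidal_category = monoidal_category C
  for C :: "('o, 'a, 'm) symmoncat_scheme" (structure) +
  assumes sym_hom: "\<lbrakk>X \<in> Obj C; Y \<in> Obj C\<rbrakk> \<Longrightarrow> sym C X Y \<in> hom C (X \<otimes> Y) (Y \<otimes> X)"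
    and sym_natural: "\<lbrakk>f \<in> hom C X X'; g \<in> hom C Y Y'\<rbrakk>
      \<Longrightarrow> sym C X' Y' \<cdot> (f \<boxtimes> g) = (g \<boxtimes> f) \<cdot> sym C X Y"
    and sym_involutive: "\<lbrakk>X \<in> Obj C; Y \<in> Obj C\<rbrakk> \<Longrightarrow> sym C Y X \<cdot> sym C X Y = Id C (X \<otimes> Y)"
    and sym_unit: "X \<in> Obj C \<Longrightarrow> lunit C X \<cdot> sym C X (Unit C) = runit C X"
    and hexagon: "\<lbrakk>X \<in> Obj C; Y \<in> Obj C; Z \<in> Obj C\<rbrakk>
      \<Longrightarrow> assoc C Y Z X \<cdot> sym C X (Y \<otimes> Z) \<cdot> assoc C X Y Z
        = (Id C Y \<boxtimes> sym C X Z) \<cdot> assoc C Y X Z \<cdot> (sym C X Y \<boxtimes> Id C Z)"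

section \<open>Strong monads\<close>

record ('o, 'a) strmonad = "('o, 'a, 'o, 'a) func" +
  unit :: "'o \<Rightarrow> 'a"
  mult :: "'o \<Rightarrow> 'a"
  strength :: "'o \<Rightarrow> 'o \<Rightarrow> 'a"

locale strong_monad = monoidal_category C + cat_functor C C T
  for C :: "('o, 'a, 'm) moncat_scheme" (structure) and T :: "('o, 'a) strmonad" +
  assumes unit_hom: "X \<in> Obj C \<Longrightarrow> unit T X \<in> hom C X (OMap T X)"
    and unit_natural: "f \<in> hom C X Y \<Longrightarrow> unit T Y \<cdot> f = AMap T f \<cdot> unit T X"
    and mult_hom: "X \<in> Obj C \<Longrightarrow> mult T X \<in> hom C (OMap T (OMap T X)) (OMap T X)"
    and mult_natural: "f \<in> hom C X Y \<Longrightarrow> mult T Y \<cdot> AMap T (AMap T f) = AMap T f \<cdot> mult T X"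
    and mult_unit_left: "X \<in> Obj C \<Longrightarrow> mult T X \<cdot> unit T (OMap T X) = Id C (OMap T X)"
    and mult_unit_right: "X \<in> Obj C \<Longrightarrow> mult T X \<cdot> AMap T (unit T X) = Id C (OMap T X)"
    and mult_mult: "X \<in> Obj C
      \<Longrightarrow> mult T X \<cdot> mult T (OMap T X) = mult T X \<cdot> AMap T (mult T X)"
    and strength_hom: "\<lbrakk>X \<in> Obj C; Y \<in> Obj C\<rbrakk>
      \<Longrightarrow> strength T X Y \<in> hom C (X \<otimes> OMap T Y) (OMap T (X \<otimes> Y))"
    and strength_natural: "\<lbrakk>f \<in> hom C X X'; g \<in> hom C Y Y'\<rbrakk>
      \<Longrightarrow> strength T X' Y' \<cdot> (f \<boxtimes> AMap T g) = AMap T (f \<boxtimes> g) \<cdot> strength T X Y"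
    and strength_lunit: "X \<in> Obj C
      \<Longrightarrow> AMap T (lunit C X) \<cdot> strength T (Unit C) X = lunit C (OMap T X)"
    and strength_assoc: "\<lbrakk>X \<in> Obj C; Y \<in> Obj C; Z \<in> Obj C\<rbrakk>
      \<Longrightarrow> AMap T (assoc C X Y Z) \<cdot> strength T (X \<otimes> Y) Z
        = strength T X (Y \<otimes> Z) \<cdot> (Id C X \<boxtimes> strength T Y Z) \<cdot> assoc C X Y (OMap T Z)"
    and strength_unit: "\<lbrakk>X \<in> Obj C; Y \<in> Obj C\<rbrakk>
      \<Longrightarrow> strength T X Y \<cdot> (Id C X \<boxtimes> unit T Y) = unit T (X \<otimes> Y)"
    and strength_mult: "\<lbrakk>X \<in> Obj C; Y \<in> Obj C\<rbrakk>
      \<Longrightarrow> strength T X Y \<cdot> (Id C X \<boxtimes> mult T Y)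
        = mult T (X \<otimes> Y) \<cdot> AMap T (strength T X Y) \<cdot> strength T X (OMap T Y)"

locale strong_monad_morphism = S: strong_monad C S + T: strong_monad C T
  for C :: "('o, 'a, 'm) moncat_scheme" (structure)
    and S :: "('o, 'a) strmonad" and T :: "('o, 'a) strmonad" +
  fixes i :: "'o \<Rightarrow> 'a"
  assumes component_hom: "X \<in> Obj C \<Longrightarrow> i X \<in> hom C (OMap S X) (OMap T X)"
    and component_natural: "f \<in> hom C X Y \<Longrightarrow> i Y \<cdot> AMap S f = AMap T f \<cdot> i X"
    and component_unit: "X \<in> Obj C \<Longrightarrow> i X \<cdot> unit S X = unit T X"
    and component_mult: "X \<in> Obj C
      \<Longrightarrow> i X \<cdot> mult S X = mult T X \<cdot> AMap T (i X) \<cdot> i (OMap S X)"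
    and component_strength: "\<lbrakk>X \<in> Obj C; Y \<in> Obj C\<rbrakk>
      \<Longrightarrow> i (X \<otimes> Y) \<cdot> strength S X Y = strength T X Y \<cdot> (Id C X \<boxtimes> i Y)"

text \<open>A monomorphism in the category of strong monads on \<open>C\<close> and their morphisms; it is not
  required that the components be monomorphisms of \<open>C\<close>.\<close>

definition strong_monad_monomorphism ::
  "('o, 'a, 'm) moncat_scheme \<Rightarrow> ('o, 'a) strmonad \<Rightarrow> ('o, 'a) strmonad \<Rightarrow> ('o \<Rightarrow> 'a) \<Rightarrow> bool" where
  "strong_monad_monomorphism C S T i \<longleftrightarrow> strong_monad_morphism C S T i \<and>
     (\<forall>R p q. strong_monad_morphism C R S p \<and> strong_monad_morphism C R S q \<and>
        (\<forall>X \<in> Obj C. i X \<cdot>\<^bsub>C\<^esub> p X = i X \<cdot>\<^bsub>C\<^esub> q X) \<longrightarrow> (\<forall>X \<in> Obj C. p X = q X))"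

section \<open>Centrality\<close>

context
  fixes C :: "('o, 'a) symmoncat" (structure) and T :: "('o, 'a) strmonad"
begin

definition right_strength :: "'o \<Rightarrow> 'o \<Rightarrow> 'a" where
  "right_strength X Y = AMap T (sym C Y X) \<cdot> strength T Y X \<cdot> sym C (OMap T X) Y"

definition double_strength :: "'o \<Rightarrow> 'o \<Rightarrow> 'a" where
  "double_strength X Y =
     mult T (X \<otimes> Y) \<cdot> AMap T (right_strength X Y) \<cdot> strength T (OMap T X) Y"

definition double_strength' :: "'o \<Rightarrow> 'o \<Rightarrow> 'a" where
  "double_strength' X Y =
     mult T (X \<otimes> Y) \<cdot> AMap T (strength T X Y) \<cdot> right_strength X (OMap T Y)"

definition commutative_strong_monad :: bool where
  "commutative_strong_monad \<longleftrightarrow> symmetric_monoidal_category C \<and> strong_monad C T \<and>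
     (\<forall>X \<in> Obj C. \<forall>Y \<in> Obj C. double_strength X Y = double_strength' X Y)"

definition central_cone :: "'o \<Rightarrow> 'o \<times> 'a \<Rightarrow> bool" where
  "central_cone X = (\<lambda>(Z, i). Z \<in> Obj C \<and> i \<in> hom C Z (OMap T X) \<and>
     (\<forall>Y \<in> Obj C. double_strength X Y \<cdot> (i \<boxtimes> Id C (OMap T Y))
                = double_strength' X Y \<cdot> (i \<boxtimes> Id C (OMap T Y))))"

text \<open>An arrow of the category of central cones carries its domain and codomain, so that hom-sets
  are disjoint; likewise for Kleisli arrows below.\<close>

definition central_cone_category ::
  "'o \<Rightarrow> ('o \<times> 'a, ('o \<times> 'a) \<times> 'a \<times> ('o \<times> 'a)) cat" where
  "central_cone_category X =
    \<lparr> Obj = {c. central_cone X c},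
      Arr = {((Z', i'), \<phi>, (Z, i)) | Z' i' \<phi> Z i.
        central_cone X (Z', i') \<and> central_cone X (Z, i) \<and> \<phi> \<in> hom C Z' Z \<and> i \<cdot> \<phi> = i'},
      Dom = (\<lambda>(c', \<phi>, c). c'),
      Cod = (\<lambda>(c', \<phi>, c). c),
      Id = (\<lambda>(Z, i). ((Z, i), Id C Z, (Z, i))),
      Comp = (\<lambda>(_, \<psi>, c) (c'', \<phi>, _). (c'', \<psi> \<cdot> \<phi>, c)) \<rparr>"

definition terminal_central_cone :: "'o \<Rightarrow> 'o \<times> 'a \<Rightarrow> bool" where
  "terminal_central_cone X c \<longleftrightarrow> terminal_object (central_cone_category X) c"

definition centralisable :: bool where
  "centralisable \<longleftrightarrow> (\<forall>X \<in> Obj C. \<exists>c. terminal_central_cone X c)"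

text \<open>In \<open>kleisli_comp Z g f\<close> the object \<open>Z\<close> is the Kleisli codomain of \<open>g\<close>; it cannot be
  recovered from the underlying arrow \<open>g : Y \<rightarrow> T Z\<close>.  The object arguments of the two
  whiskerings are Kleisli codomains for the same reason.\<close>

definition kleisli_comp :: "'o \<Rightarrow> 'a \<Rightarrow> 'a \<Rightarrow> 'a" where
  "kleisli_comp Z g f = mult T Z \<cdot> AMap T g \<cdot> f"

definition kleisli_category :: "('o, 'o \<times> 'a \<times> 'o) cat" where
  "kleisli_category =
    \<lparr> Obj = Obj C,
      Arr = {(X, f, Y) | X f Y. X \<in> Obj C \<and> Y \<in> Obj C \<and> f \<in> hom C X (OMap T Y)},
      Dom = (\<lambda>(X, f, Y). X),
      Cod = (\<lambda>(X, f, Y). Y),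
      Id = (\<lambda>X. (X, unit T X, X)),
      Comp = (\<lambda>(_, g, Z) (X, f, _). (X, kleisli_comp Z g f, Z)) \<rparr>"

definition left_whisker :: "'o \<Rightarrow> 'a \<Rightarrow> 'o \<Rightarrow> 'a" where
  "left_whisker Y f W = right_strength Y W \<cdot> (f \<boxtimes> Id C W)"

definition right_whisker :: "'o \<Rightarrow> 'o \<Rightarrow> 'a \<Rightarrow> 'a" where
  "right_whisker W Y f = strength T W Y \<cdot> (Id C W \<boxtimes> f)"

definition central_kleisli_arrow :: "'o \<times> 'a \<times> 'o \<Rightarrow> bool" where
  "central_kleisli_arrow = (\<lambda>(X, f, Y). (X, f, Y) \<in> Arr kleisli_category \<and>
     (\<forall>X' f' Y'. (X', f', Y') \<in> Arr kleisli_category \<longrightarrow>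
        kleisli_comp (Y \<otimes> Y') (right_whisker Y Y' f') (left_whisker Y f X')
      = kleisli_comp (Y \<otimes> Y') (left_whisker Y f Y') (right_whisker X Y' f')))"

definition premonoidal_centre :: "('o, 'o \<times> 'a \<times> 'o) cat" where
  "premonoidal_centre = kleisli_category \<lparr> Arr := {f. central_kleisli_arrow f} \<rparr>"

end

definition kleisli_embedding ::
  "('o, 'a) symmoncat \<Rightarrow> ('o \<Rightarrow> 'a) \<Rightarrow> ('o, 'o \<times> 'a \<times> 'o, 'o, 'o \<times> 'a \<times> 'o) func" where
  "kleisli_embedding C i =
    \<lparr> OMap = (\<lambda>X. X), AMap = (\<lambda>(X, f, Y). (X, i Y \<cdot>\<^bsub>C\<^esub> f, Y)) \<rparr>"

definition commutative_submonad_structure ::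
  "('o, 'a) symmoncat \<Rightarrow> ('o, 'a) strmonad \<Rightarrow> ('o \<Rightarrow> 'o) \<Rightarrow> ('o \<Rightarrow> 'a) \<Rightarrow> ('o, 'a) strmonad \<Rightarrow> bool"
where
  "commutative_submonad_structure C T Z i M \<longleftrightarrow>
     (\<forall>X \<in> Obj C. OMap M X = Z X) \<and>
     commutative_strong_monad C M \<and> strong_monad_monomorphism C M T i"

end

(* Centrality of a Kleisli arrow f : A -> T X says that the two double strengths agree after
   precomposition with f and any f'; taking f' = id on T Y shows that this is exactly the central
   cone condition on (A, f).  Cones are closed under precomposition, Kleisli composition and
   whiskering by the strength (the last by compatibility of the left and right strengths), so all
   structure maps of T restrict along iota to arrows into Z; uniqueness of factorisations makes
   every iota X monic, which transports all equations from T to Z.  The inverse of the embedding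
   sends a central arrow to its factorisation through iota. *)

theory Submission
  imports Defs
begin

text \<open>The axioms speak only of \<open>strength\<close>. The laws of the right strength have to
  be derived by conjugating with the symmetry, and its compatibility with the left strength takes
  the hexagon twice, once under T at an object X and once outside at T X.

  Composition is total on untyped arrows, so every rewrite carries side conditions on domains and
  codomains. The equational proofs therefore share one normal form: composites nested to the right,
  with whiskerings and \<open>AMap\<close> distributed over them.

  Two claims remain separate. A commutative structure on Z is constructed from factorisations,
  whereas the isomorphism concerns an arbitrary such structure, which may differ from the
  constructed one outside the objects and arrows of C. Functoriality of the inverse is not computed
  from its formula; it follows from functoriality and faithfulness of the embedding.\<close>

section \<open>Normal forms for composites in a category\<close>

context category
begin

lemma homD:
  assumes "f \<in> hom C X Y"
  shows "f \<in> Arr C" "Dom C f = X" "Cod C f = Y"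
  using assms by (auto simp: hom_def)

lemma homI: "\<lbrakk>f \<in> Arr C; Dom C f = X; Cod C f = Y\<rbrakk> \<Longrightarrow> f \<in> hom C X Y"
  by (simp add: hom_def)

lemma arr_hom: "f \<in> Arr C \<Longrightarrow> f \<in> hom C (Dom C f) (Cod C f)"
  by (simp add: hom_def)

lemma typing_Id [simp]:
  assumes "X \<in> Obj C"
  shows "Id C X \<in> Arr C" "Dom C (Id C X) = X" "Cod C (Id C X) = X"
  using homD[OF Id_hom[OF assms]] by auto

lemma typing_Comp [simp]:
  assumes "f \<in> Arr C" "g \<in> Arr C" "Cod C f = Dom C g"
  shows "g \<cdot> f \<in> Arr C" "Dom C (g \<cdot> f) = Dom C f" "Cod C (g \<cdot> f) = Cod C g"
  using homD[OF Comp_hom[of f "Dom C f" "Cod C f" g "Cod C g"]] assms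
  by (auto simp: hom_def)

lemma Comp_Id' [simp]: "\<lbrakk>f \<in> Arr C; Dom C f = X\<rbrakk> \<Longrightarrow> f \<cdot> Id C X = f"
  using Comp_Id arr_hom by metis

lemma Id_Comp' [simp]: "\<lbrakk>f \<in> Arr C; Cod C f = X\<rbrakk> \<Longrightarrow> Id C X \<cdot> f = f"
  using Id_Comp arr_hom by metis

lemma Comp_assoc' [simp]:
  "\<lbrakk>f \<in> Arr C; g \<in> Arr C; h \<in> Arr C; Cod C f = Dom C g; Cod C g = Dom C h\<rbrakk>
    \<Longrightarrow> (h \<cdot> g) \<cdot> f = h \<cdot> (g \<cdot> f)"
  using Comp_assoc arr_hom by metis

text \<open>In a composite nested to the right, \<open>a \<cdot> b\<close> is no longer a subterm
  once another arrow precedes it. This form lets an equation rewrite inside a longer chain.\<close>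

lemma reassoc:
  "\<lbrakk>a \<cdot> b = c; a \<in> Arr C; b \<in> Arr C; k \<in> Arr C; Cod C b = Dom C a; Cod C k = Dom C b\<rbrakk>
    \<Longrightarrow> a \<cdot> (b \<cdot> k) = c \<cdot> k"
  using Comp_assoc' by metis

lemma Obj_Dom_Cod [simp]: "f \<in> Arr C \<Longrightarrow> Dom C f \<in> Obj C" "f \<in> Arr C \<Longrightarrow> Cod C f \<in> Obj C"
  using Dom_Obj Cod_Obj by auto

end

section \<open>Whiskering and cancellation of associators\<close>

context monoidal_category
begin

declare tensor_Obj [simp] Unit_Obj [simp] tensor_Id [simp]

lemma typing_tensor [simp]:
  assumes "f \<in> Arr C" "g \<in> Arr C"
  shows "f \<boxtimes> g \<in> Arr C" "Dom C (f \<boxtimes> g) = Dom C f \<otimes> Dom C g"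
    "Cod C (f \<boxtimes> g) = Cod C f \<otimes> Cod C g"
  using homD[OF tensor_hom[OF arr_hom[OF assms(1)] arr_hom[OF assms(2)]]] by auto

lemma whisker_Comp [simp]:
  assumes "X \<in> Obj C" "f \<in> Arr C" "g \<in> Arr C" "Cod C f = Dom C g"
  shows "Id C X \<boxtimes> (g \<cdot> f) = (Id C X \<boxtimes> g) \<cdot> (Id C X \<boxtimes> f)"
    "(g \<cdot> f) \<boxtimes> Id C X = (g \<boxtimes> Id C X) \<cdot> (f \<boxtimes> Id C X)"
  using tensor_Comp[OF Id_hom[OF assms(1)] Id_hom[OF assms(1)], of f "Dom C f" "Dom C g" g "Cod C g"]
    tensor_Comp[OF _ _ Id_hom[OF assms(1)] Id_hom[OF assms(1)], of f "Dom C f" "Dom C g" g "Cod C g"]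
    assms by (auto simp: hom_def)

text \<open>Since \<open>whisker_Comp\<close> splits whiskered composites, an equation to be used
  inside a whiskering must be offered in split form.\<close>

lemma whisker_eq:
  assumes "a \<cdot> b = c" "X \<in> Obj C" "a \<in> Arr C" "b \<in> Arr C" "Cod C b = Dom C a"
  shows "(Id C X \<boxtimes> a) \<cdot> (Id C X \<boxtimes> b) = Id C X \<boxtimes> c"
  using assms by (metis whisker_Comp(1))

lemma interchange:
  assumes "f \<in> Arr C" "g \<in> Arr C" "Dom C f = X" "Cod C f = X'" "Dom C g = Y" "Cod C g = Y'"
  shows "(f \<boxtimes> Id C Y') \<cdot> (Id C X \<boxtimes> g) = f \<boxtimes> g"
    "(Id C X' \<boxtimes> g) \<cdot> (f \<boxtimes> Id C Y) = f \<boxtimes> g"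
  using tensor_Comp[of "Id C X" X X f X' g Y Y' "Id C Y'" Y'] Obj_Dom_Cod[OF assms(1)]
    tensor_Comp[of f X X' "Id C X'" X' "Id C Y" Y Y g Y'] Obj_Dom_Cod[OF assms(2)] assms
  by (auto simp: hom_def)

lemma typing_assoc [simp]:
  assumes "X \<in> Obj C" "Y \<in> Obj C" "W \<in> Obj C"
  shows "assoc C X Y W \<in> Arr C" "Dom C (assoc C X Y W) = (X \<otimes> Y) \<otimes> W"
    "Cod C (assoc C X Y W) = X \<otimes> (Y \<otimes> W)"
  using assoc_iso[OF assms] by (auto simp: iso_arrow_def hom_def)

lemma typing_lunit [simp]:
  assumes "X \<in> Obj C"
  shows "lunit C X \<in> Arr C" "Dom C (lunit C X) = Unit C \<otimes> X" "Cod C (lunit C X) = X"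
  using lunit_iso[OF assms] by (auto simp: iso_arrow_def hom_def)

text \<open>Precomposition with the inverse associator cancels it.\<close>

lemma assoc_epi:
  assumes "X \<in> Obj C" "Y \<in> Obj C" "W \<in> Obj C" "f \<in> Arr C" "g \<in> Arr C"
    "Dom C f = X \<otimes> (Y \<otimes> W)" "Dom C g = X \<otimes> (Y \<otimes> W)"
    and eq: "f \<cdot> assoc C X Y W = g \<cdot> assoc C X Y W"
  shows "f = g"
proof -
  obtain b where b: "b \<in> hom C (X \<otimes> (Y \<otimes> W)) ((X \<otimes> Y) \<otimes> W)"
    "assoc C X Y W \<cdot> b = Id C (X \<otimes> (Y \<otimes> W))"
    using assoc_iso[OF assms(1-3)] by (auto simp: iso_arrow_def)
  note [simp] = homD[OF b(1)]
  have "f \<cdot> (assoc C X Y W \<cdot> b) = g \<cdot> (assoc C X Y W \<cdot> b)"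
    using arg_cong[OF eq, of "\<lambda>k. k \<cdot> b"] assms(1-7) by simp
  then show ?thesis using b(2) assms by simp
qed

lemma assoc_whisker:
  assumes "X \<in> Obj C" "Y \<in> Obj C" "f \<in> Arr C" "Dom C f = W" "Cod C f = W'"
  shows "assoc C X Y W' \<cdot> (Id C (X \<otimes> Y) \<boxtimes> f) = (Id C X \<boxtimes> (Id C Y \<boxtimes> f)) \<cdot> assoc C X Y W"
    "assoc C X W' Y \<cdot> ((Id C X \<boxtimes> f) \<boxtimes> Id C Y) = (Id C X \<boxtimes> (f \<boxtimes> Id C Y)) \<cdot> assoc C X W Y"
  using assoc_natural[OF Id_hom Id_hom, of X Y f W W'] assoc_natural[OF Id_hom _ Id_hom, of X f W W' Y]
    assms by (auto simp: hom_def)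

end

context symmetric_monoidal_category
begin

lemma typing_sym [simp]:
  assumes "X \<in> Obj C" "Y \<in> Obj C"
  shows "sym C X Y \<in> Arr C" "Dom C (sym C X Y) = X \<otimes> Y" "Cod C (sym C X Y) = Y \<otimes> X"
  using homD[OF sym_hom[OF assms]] by auto

lemma sym_whisker:
  assumes "f \<in> Arr C" "Dom C f = X" "Cod C f = X'" "Y \<in> Obj C"
  shows "sym C X' Y \<cdot> (f \<boxtimes> Id C Y) = (Id C Y \<boxtimes> f) \<cdot> sym C X Y"
    "sym C Y X' \<cdot> (Id C Y \<boxtimes> f) = (f \<boxtimes> Id C Y) \<cdot> sym C Y X"
  using sym_natural[OF _ Id_hom, of f X X' Y] sym_natural[OF Id_hom, of Y f X X'] assms
  by (auto simp: hom_def)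

end

section \<open>Rewriting with the structure maps of a strong monad\<close>

context strong_monad
begin

declare OMap_Obj [simp] AMap_Id [simp]

lemma typing_AMap [simp]:
  assumes "f \<in> Arr C"
  shows "AMap T f \<in> Arr C" "Dom C (AMap T f) = OMap T (Dom C f)"
    "Cod C (AMap T f) = OMap T (Cod C f)"
  using homD[OF AMap_hom[OF arr_hom[OF assms]]] by auto

lemma AMap_Comp' [simp]:
  "\<lbrakk>f \<in> Arr C; g \<in> Arr C; Cod C f = Dom C g\<rbrakk> \<Longrightarrow> AMap T (g \<cdot> f) = AMap T g \<cdot> AMap T f"
  by (metis AMap_Comp arr_hom)

lemma typing_unit [simp]:
  assumes "X \<in> Obj C"
  shows "unit T X \<in> Arr C" "Dom C (unit T X) = X" "Cod C (unit T X) = OMap T X"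
  using homD[OF unit_hom[OF assms]] by auto

lemma typing_mult [simp]:
  assumes "X \<in> Obj C"
  shows "mult T X \<in> Arr C" "Dom C (mult T X) = OMap T (OMap T X)" "Cod C (mult T X) = OMap T X"
  using homD[OF mult_hom[OF assms]] by auto

lemma typing_strength [simp]:
  assumes "X \<in> Obj C" "Y \<in> Obj C"
  shows "strength T X Y \<in> Arr C" "Dom C (strength T X Y) = X \<otimes> OMap T Y"
    "Cod C (strength T X Y) = OMap T (X \<otimes> Y)"
  using homD[OF strength_hom[OF assms]] by auto

lemma unit_nat:
  "\<lbrakk>f \<in> Arr C; Dom C f = X; Cod C f = Y\<rbrakk> \<Longrightarrow> unit T Y \<cdot> f = AMap T f \<cdot> unit T X"
  using unit_natural arr_hom by metis

lemma mult_nat: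
  "\<lbrakk>f \<in> Arr C; Dom C f = X; Cod C f = Y\<rbrakk> \<Longrightarrow> mult T Y \<cdot> AMap T (AMap T f) = AMap T f \<cdot> mult T X"
  using mult_natural arr_hom by metis

lemma strength_nat:
  assumes "f \<in> Arr C" "Dom C f = X" "Cod C f = X'" "Y \<in> Obj C"
  shows "strength T X' Y \<cdot> (f \<boxtimes> Id C (OMap T Y)) = AMap T (f \<boxtimes> Id C Y) \<cdot> strength T X Y"
    "strength T Y X' \<cdot> (Id C Y \<boxtimes> AMap T f) = AMap T (Id C Y \<boxtimes> f) \<cdot> strength T Y X"
  using strength_natural[OF _ Id_hom, of f X X' Y] strength_natural[OF Id_hom, of Y f X X'] assms
  by (auto simp: hom_def)

text \<open>The counterpart of \<open>whisker_eq\<close> for equations under the functor, which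
  \<open>AMap_Comp'\<close> splits likewise.\<close>

lemma AMap_eq:
  assumes "a \<cdot> b = c" "a \<in> Arr C" "b \<in> Arr C" "Cod C b = Dom C a"
  shows "AMap T a \<cdot> AMap T b = AMap T c"
  using assms by (metis AMap_Comp')

end

section \<open>The right strength and its compatibility with the left strength\<close>

locale symmetric_strong_monad = symmetric_monoidal_category C + strong_monad C T
  for C :: "('o, 'a) symmoncat" (structure) and T :: "('o, 'a) strmonad"
begin

abbreviation "rstr \<equiv> right_strength C T"
abbreviation "dstr \<equiv> double_strength C T"
abbreviation "dstr' \<equiv> double_strength' C T"

lemma typing_right_strength [simp]:
  assumes "X \<in> Obj C" "Y \<in> Obj C"
  shows "rstr X Y \<in> Arr C" "Dom C (rstr X Y) = OMap T X \<otimes> Y" "Cod C (rstr X Y) = OMap T (X \<otimes> Y)"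
  using assms by (auto simp: right_strength_def)

lemma typing_double_strength [simp]:
  assumes "X \<in> Obj C" "Y \<in> Obj C"
  shows "dstr X Y \<in> Arr C" "Dom C (dstr X Y) = OMap T X \<otimes> OMap T Y"
    "Cod C (dstr X Y) = OMap T (X \<otimes> Y)"
    "dstr' X Y \<in> Arr C" "Dom C (dstr' X Y) = OMap T X \<otimes> OMap T Y"
    "Cod C (dstr' X Y) = OMap T (X \<otimes> Y)"
  using assms by (auto simp: double_strength_def double_strength'_def)

lemma right_strength_nat:
  assumes "f \<in> Arr C" "Dom C f = X" "Cod C f = X'" "Y \<in> Obj C"
  shows "rstr X' Y \<cdot> (AMap T f \<boxtimes> Id C Y) = AMap T (f \<boxtimes> Id C Y) \<cdot> rstr X Y"
    "rstr Y X' \<cdot> (Id C (OMap T Y) \<boxtimes> f) = AMap T (Id C Y \<boxtimes> f) \<cdot> rstr Y X"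
proof -
  have [simp]: "X \<in> Obj C" "X' \<in> Obj C" using assms by auto
  note [simp] = assms
  show "rstr X' Y \<cdot> (AMap T f \<boxtimes> Id C Y) = AMap T (f \<boxtimes> Id C Y) \<cdot> rstr X Y"
    by (simp add: right_strength_def sym_whisker strength_nat reassoc[OF strength_nat(2)]
        reassoc[OF AMap_eq[OF sym_whisker(2)]])
  show "rstr Y X' \<cdot> (Id C (OMap T Y) \<boxtimes> f) = AMap T (Id C Y \<boxtimes> f) \<cdot> rstr Y X"
    by (simp add: right_strength_def sym_whisker strength_nat reassoc[OF strength_nat(1)]
        reassoc[OF AMap_eq[OF sym_whisker(1)]])
qed

lemma right_strength_unit:
  assumes [simp]: "X \<in> Obj C" "Y \<in> Obj C"
  shows "rstr X Y \<cdot> (unit T X \<boxtimes> Id C Y) = unit T (X \<otimes> Y)"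
  by (simp add: right_strength_def sym_whisker reassoc[OF strength_unit] unit_nat
      reassoc[OF unit_nat[symmetric]] sym_involutive flip: unit_nat)

lemma AMap_sym_involutive:
  assumes [simp]: "X \<in> Obj C" "Y \<in> Obj C"
  shows "AMap T (sym C Y X) \<cdot> AMap T (sym C X Y) = Id C (OMap T (X \<otimes> Y))"
  by (simp add: sym_involutive flip: AMap_Comp')

text \<open>Conjugate of \<open>strength_mult\<close>: on the right-hand side the two symmetries
  between the consecutive strengths meet under T and cancel.\<close>

lemma right_strength_mult:
  assumes [simp]: "X \<in> Obj C" "Y \<in> Obj C"
  shows "rstr X Y \<cdot> (mult T X \<boxtimes> Id C Y) = mult T (X \<otimes> Y) \<cdot> AMap T (rstr X Y) \<cdot> rstr (OMap T X) Y"
  by (simp add: right_strength_def sym_whisker reassoc[OF strength_mult] 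
      reassoc[OF mult_nat] reassoc[OF AMap_sym_involutive])

text \<open>The hexagon for Y, A, W, solved for its right-hand composite by cancelling one symmetry
  with its inverse.\<close>

lemma assoc_sym:
  assumes [simp]: "A \<in> Obj C" "W \<in> Obj C" "Y \<in> Obj C"
  shows "assoc C A Y W \<cdot> (sym C Y A \<boxtimes> Id C W)
    = (Id C A \<boxtimes> sym C W Y) \<cdot> assoc C A W Y \<cdot> sym C Y (A \<otimes> W) \<cdot> assoc C Y A W"
proof -
  have eq: "(Id C A \<boxtimes> sym C W Y) \<cdot> (Id C A \<boxtimes> sym C Y W) = Id C (A \<otimes> (Y \<otimes> W))"
    by (simp add: sym_involutive flip: whisker_Comp)
  show ?thesis by (simp add: hexagon reassoc[OF eq])
qed

text \<open>Checked after precomposition with the isomorphism \<open>(Y \<otimes> A) \<otimes> T X \<rightarrow> (A \<otimes> T X) \<otimes> Y\<close>, where the hexagon applies.\<close>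

lemma bistrength:
  assumes [simp]: "A \<in> Obj C" "X \<in> Obj C" "Y \<in> Obj C"
  shows "AMap T (assoc C A X Y) \<cdot> rstr (A \<otimes> X) Y \<cdot> (strength T A X \<boxtimes> Id C Y)
    = strength T A (X \<otimes> Y) \<cdot> (Id C A \<boxtimes> rstr X Y) \<cdot> assoc C A (OMap T X) Y"
    (is "?l = ?r")
proof -
  let ?s = "sym C Y (A \<otimes> OMap T X)"
  \<comment> \<open>\<open>?l'\<close> is \<open>?l\<close> without its last symmetry: after
    unfolding the right strength, that symmetry slides past the whiskered strength to the far
    right.\<close>
  let ?l' = "AMap T (assoc C A X Y \<cdot> sym C Y (A \<otimes> X)) \<cdot> strength T Y (A \<otimes> X)
    \<cdot> (Id C Y \<boxtimes> strength T A X)"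
  have "?l' \<cdot> assoc C Y A (OMap T X)
    = AMap T (assoc C A X Y \<cdot> sym C Y (A \<otimes> X) \<cdot> assoc C Y A X) \<cdot> strength T (Y \<otimes> A) X"
    by (simp add: strength_assoc)
  also have "\<dots> = AMap T (Id C A \<boxtimes> sym C Y X) \<cdot> AMap T (assoc C A Y X)
    \<cdot> AMap T (sym C Y A \<boxtimes> Id C X) \<cdot> strength T (Y \<otimes> A) X"
    by (simp only: hexagon assms) simp
  also have "\<dots> = AMap T (Id C A \<boxtimes> sym C Y X) \<cdot> AMap T (assoc C A Y X)
    \<cdot> strength T (A \<otimes> Y) X \<cdot> (sym C Y A \<boxtimes> Id C (OMap T X))"
    by (simp add: strength_nat)
  also have "\<dots> = AMap T (Id C A \<boxtimes> sym C Y X) \<cdot> strength T A (Y \<otimes> X) \<cdot> (Id C A \<boxtimes> strength T Y X)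
    \<cdot> (assoc C A Y (OMap T X) \<cdot> (sym C Y A \<boxtimes> Id C (OMap T X)))"
    by (simp add: reassoc[OF strength_assoc])
  \<comment> \<open>\<open>assoc_sym\<close> creates the symmetries that turn the whiskered strength
    into the right strength \<open>rstr X Y\<close>.\<close>
  also have "\<dots> = (?r \<cdot> ?s) \<cdot> assoc C Y A (OMap T X)"
    by (simp add: assoc_sym right_strength_def reassoc[OF strength_nat(2)])
  finally have "?l' = ?r \<cdot> ?s"
    by (rule assoc_epi[rotated -1]) simp_all
  then have "?l' \<cdot> sym C (A \<otimes> OMap T X) Y = (?r \<cdot> ?s) \<cdot> sym C (A \<otimes> OMap T X) Y"
    by simp
  then show ?thesis
    by (simp add: right_strength_def sym_involutive sym_whisker)
qed


section \<open>Central cones\<close>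

abbreviation "cone \<equiv> central_cone C T"
abbreviation "lwhisk \<equiv> left_whisker C T"

lemma coneD:
  assumes "cone X (A, f)"
  shows "A \<in> Obj C" "f \<in> Arr C" "Dom C f = A" "Cod C f = OMap T X"
    "Y \<in> Obj C \<Longrightarrow> dstr X Y \<cdot> (f \<boxtimes> Id C (OMap T Y)) = dstr' X Y \<cdot> (f \<boxtimes> Id C (OMap T Y))"
  using assms by (auto simp: central_cone_def hom_def)

lemma coneI:
  assumes "f \<in> Arr C" "Dom C f = A" "Cod C f = OMap T X"
    "\<And>Y. Y \<in> Obj C \<Longrightarrow> dstr X Y \<cdot> (f \<boxtimes> Id C (OMap T Y)) = dstr' X Y \<cdot> (f \<boxtimes> Id C (OMap T Y))"
  shows "cone X (A, f)"
  using assms Dom_Obj[of f] by (auto simp: central_cone_def hom_def)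

lemma typing_left_whisker [simp]:
  assumes "f \<in> Arr C" "Cod C f = OMap T X" "X \<in> Obj C" "Y \<in> Obj C"
  shows "lwhisk X f Y \<in> Arr C" "Dom C (lwhisk X f Y) = Dom C f \<otimes> Y"
    "Cod C (lwhisk X f Y) = OMap T (X \<otimes> Y)"
  using assms by (auto simp: left_whisker_def)

text \<open>Puts the cone condition into Kleisli form: whiskering by f commutes with the strength,
  regarded as a Kleisli arrow. The first equation moves f under T by naturality of the
  strength.\<close>

lemma double_strength_whisker:
  assumes [simp]: "f \<in> Arr C" "Dom C f = A" "Cod C f = OMap T X" "X \<in> Obj C" "Y \<in> Obj C"
  shows "dstr X Y \<cdot> (f \<boxtimes> Id C (OMap T Y))
      = mult T (X \<otimes> Y) \<cdot> AMap T (lwhisk X f Y) \<cdot> strength T A Y"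
    "dstr' X Y \<cdot> (f \<boxtimes> Id C (OMap T Y))
      = mult T (X \<otimes> Y) \<cdot> AMap T (strength T X Y) \<cdot> lwhisk X f (OMap T Y)"
  using Dom_Obj[of f]
  by (simp_all add: double_strength_def double_strength'_def left_whisker_def strength_nat)

text \<open>Left whiskering preserves Kleisli composition, because the right strength is compatible
  with \<open>mult\<close>.\<close>

lemma left_whisker_comp:
  assumes [simp]: "f \<in> Arr C" "Cod C f = OMap T X" "g \<in> Arr C" "Dom C g = X"
    "Cod C g = OMap T W" "W \<in> Obj C" "Y \<in> Obj C"
  shows "lwhisk W (mult T W \<cdot> AMap T g \<cdot> f) Y
    = mult T (W \<otimes> Y) \<cdot> AMap T (lwhisk W g Y) \<cdot> lwhisk X f Y"
proof -
  have [simp]: "X \<in> Obj C" using Dom_Obj[of g] by simp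
  show ?thesis
    by (simp add: left_whisker_def reassoc[OF right_strength_mult] reassoc[OF right_strength_nat(1)])
qed

text \<open>Both sides collapse to \<open>strength T X Y\<close>, one by each unit law of the
  monad.\<close>

lemma cone_unit:
  assumes [simp]: "X \<in> Obj C"
  shows "cone X (X, unit T X)"
proof (rule coneI)
  fix Y assume [simp]: "Y \<in> Obj C"
  show "dstr X Y \<cdot> (unit T X \<boxtimes> Id C (OMap T Y)) = dstr' X Y \<cdot> (unit T X \<boxtimes> Id C (OMap T Y))"
    by (simp add: double_strength_whisker[where A=X] left_whisker_def right_strength_unit
        reassoc[OF mult_unit_right] reassoc[OF mult_unit_left] flip: unit_nat)
qed simp_all

lemma cone_Comp:
  assumes f: "cone X (A, f)" and [simp]: "X \<in> Obj C" "g \<in> Arr C" "Dom C g = B" "Cod C g = A"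
  shows "cone X (B, f \<cdot> g)"
proof (rule coneI)
  note [simp] = coneD[OF f]
  fix Y assume [simp]: "Y \<in> Obj C"
  show "dstr X Y \<cdot> ((f \<cdot> g) \<boxtimes> Id C (OMap T Y)) = dstr' X Y \<cdot> ((f \<cdot> g) \<boxtimes> Id C (OMap T Y))"
    by (simp add: reassoc[OF coneD(5)[OF f]])
qed (use coneD[OF f] in simp_all)

text \<open>The whiskering of a Kleisli composite splits into those of f and g, and the strength
  moves past them one at a time. Each rebracketing is Kleisli associativity, that is
  \<open>mult_mult\<close> together with \<open>mult_nat\<close>.\<close>

lemma cone_kleisli_comp:
  assumes f: "cone X (A, f)" and g: "cone W (X, g)" and [simp]: "W \<in> Obj C"
  shows "cone W (A, mult T W \<cdot> AMap T g \<cdot> f)"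
proof (rule coneI)
  note [simp] = coneD(1-4)[OF f] coneD(1-4)[OF g]
  fix Y assume [simp]: "Y \<in> Obj C"
  note dswf = double_strength_whisker[of f A X Y, simplified]
  note dswg = double_strength_whisker[of g X W Y, simplified]
  have "dstr W Y \<cdot> ((mult T W \<cdot> AMap T g \<cdot> f) \<boxtimes> Id C (OMap T Y))
    = mult T (W \<otimes> Y) \<cdot> AMap T (lwhisk W (mult T W \<cdot> AMap T g \<cdot> f) Y) \<cdot> strength T A Y"
    by (rule double_strength_whisker) simp_all
  also have "\<dots> = mult T (W \<otimes> Y) \<cdot> AMap T (mult T (W \<otimes> Y)) \<cdot> AMap T (AMap T (lwhisk W g Y))
      \<cdot> AMap T (lwhisk X f Y) \<cdot> strength T A Y"
    by (simp add: left_whisker_comp del: whisker_Comp)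
  also have "\<dots> = mult T (W \<otimes> Y) \<cdot> AMap T (lwhisk W g Y)
      \<cdot> (mult T (X \<otimes> Y) \<cdot> AMap T (lwhisk X f Y) \<cdot> strength T A Y)"
    by (simp add: reassoc[OF mult_mult[symmetric]] reassoc[OF mult_nat])
  \<comment> \<open>The strength passes f here, and g after the next rebracketing.\<close>
  also have "mult T (X \<otimes> Y) \<cdot> AMap T (lwhisk X f Y) \<cdot> strength T A Y
      = mult T (X \<otimes> Y) \<cdot> AMap T (strength T X Y) \<cdot> lwhisk X f (OMap T Y)"
    using coneD(5)[OF f, of Y] by (simp add: dswf)
  also have "mult T (W \<otimes> Y) \<cdot> AMap T (lwhisk W g Y) \<cdot> \<dots>
      = mult T (W \<otimes> Y) \<cdot> AMap T (mult T (W \<otimes> Y) \<cdot> AMap T (lwhisk W g Y) \<cdot> strength T X Y)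
        \<cdot> lwhisk X f (OMap T Y)"
    by (simp add: reassoc[OF mult_mult[symmetric]] reassoc[OF mult_nat])
  also have "mult T (W \<otimes> Y) \<cdot> AMap T (lwhisk W g Y) \<cdot> strength T X Y
      = mult T (W \<otimes> Y) \<cdot> AMap T (strength T W Y) \<cdot> lwhisk W g (OMap T Y)"
    using coneD(5)[OF g, of Y] by (simp add: dswg)
  also have "mult T (W \<otimes> Y) \<cdot> AMap T \<dots> \<cdot> lwhisk X f (OMap T Y)
      = mult T (W \<otimes> Y) \<cdot> AMap T (strength T W Y)
        \<cdot> lwhisk W (mult T W \<cdot> AMap T g \<cdot> f) (OMap T Y)"
    by (simp add: reassoc[OF mult_mult[symmetric]] reassoc[OF mult_nat] left_whisker_comp
        del: whisker_Comp)
  also have "\<dots> = dstr' W Y \<cdot> ((mult T W \<cdot> AMap T g \<cdot> f) \<boxtimes> Id C (OMap T Y))"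
    by (rule double_strength_whisker[symmetric]) simp_all
  finally show "dstr W Y \<cdot> ((mult T W \<cdot> AMap T g \<cdot> f) \<boxtimes> Id C (OMap T Y))
    = dstr' W Y \<cdot> ((mult T W \<cdot> AMap T g \<cdot> f) \<boxtimes> Id C (OMap T Y))" .
qed (use coneD[OF f] coneD[OF g] in simp_all)

section \<open>Double strengths and tensoring on the left\<close>

lemma AMap_assoc_mono:
  assumes "X \<in> Obj C" "Y \<in> Obj C" "W \<in> Obj C" "f \<in> Arr C" "g \<in> Arr C"
    "Cod C f = OMap T ((X \<otimes> Y) \<otimes> W)" "Cod C g = OMap T ((X \<otimes> Y) \<otimes> W)"
    and eq: "AMap T (assoc C X Y W) \<cdot> f = AMap T (assoc C X Y W) \<cdot> g"
  shows "f = g"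
proof -
  obtain b where b: "b \<in> hom C (X \<otimes> (Y \<otimes> W)) ((X \<otimes> Y) \<otimes> W)"
    "b \<cdot> assoc C X Y W = Id C ((X \<otimes> Y) \<otimes> W)"
    using assoc_iso[OF assms(1-3)] by (auto simp: iso_arrow_def)
  note [simp] = homD[OF b(1)]
  have "(AMap T b \<cdot> AMap T (assoc C X Y W)) \<cdot> f = (AMap T b \<cdot> AMap T (assoc C X Y W)) \<cdot> g"
    using arg_cong[OF eq, of "\<lambda>k. AMap T b \<cdot> k"] assms(1-7) by simp
  then show ?thesis using assms(1-7) by (simp add: AMap_eq[OF b(2)] del: Comp_assoc')
qed

text \<open>Each double strength uses both strengths once, so each proof uses
  \<open>bistrength\<close> and \<open>strength_assoc\<close> once. For \<open>dstr\<close> it is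
  \<open>bistrength\<close> that is applied under T, for \<open>dstr'\<close> it is
  \<open>strength_assoc\<close>. Then \<open>strength_mult\<close> absorbs the
  multiplication.\<close>

lemma double_strength_strength:
  assumes [simp]: "A \<in> Obj C" "X \<in> Obj C" "Y \<in> Obj C"
  shows "AMap T (assoc C A X Y) \<cdot> dstr (A \<otimes> X) Y \<cdot> (strength T A X \<boxtimes> Id C (OMap T Y))
      = strength T A (X \<otimes> Y) \<cdot> (Id C A \<boxtimes> dstr X Y) \<cdot> assoc C A (OMap T X) (OMap T Y)"
    "AMap T (assoc C A X Y) \<cdot> dstr' (A \<otimes> X) Y \<cdot> (strength T A X \<boxtimes> Id C (OMap T Y))
      = strength T A (X \<otimes> Y) \<cdot> (Id C A \<boxtimes> dstr' X Y) \<cdot> assoc C A (OMap T X) (OMap T Y)"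
proof -
  have "AMap T (assoc C A X Y) \<cdot> dstr (A \<otimes> X) Y \<cdot> (strength T A X \<boxtimes> Id C (OMap T Y))
    = mult T (A \<otimes> (X \<otimes> Y))
      \<cdot> AMap T (AMap T (assoc C A X Y) \<cdot> rstr (A \<otimes> X) Y \<cdot> (strength T A X \<boxtimes> Id C Y))
      \<cdot> strength T (A \<otimes> OMap T X) Y"
    by (simp add: double_strength_def strength_nat reassoc[OF mult_nat[symmetric]])
  also have "\<dots> = mult T (A \<otimes> (X \<otimes> Y)) \<cdot> AMap T (strength T A (X \<otimes> Y))
      \<cdot> AMap T (Id C A \<boxtimes> rstr X Y) \<cdot> AMap T (assoc C A (OMap T X) Y)
      \<cdot> strength T (A \<otimes> OMap T X) Y"
    by (simp only: bistrength assms) simp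
  also have "\<dots> = strength T A (X \<otimes> Y) \<cdot> (Id C A \<boxtimes> dstr X Y) \<cdot> assoc C A (OMap T X) (OMap T Y)"
    by (simp add: double_strength_def strength_assoc reassoc[OF strength_nat(2)]
        reassoc[OF strength_mult])
  finally show "AMap T (assoc C A X Y) \<cdot> dstr (A \<otimes> X) Y \<cdot> (strength T A X \<boxtimes> Id C (OMap T Y))
      = strength T A (X \<otimes> Y) \<cdot> (Id C A \<boxtimes> dstr X Y) \<cdot> assoc C A (OMap T X) (OMap T Y)" .
  have "AMap T (assoc C A X Y) \<cdot> dstr' (A \<otimes> X) Y \<cdot> (strength T A X \<boxtimes> Id C (OMap T Y))
    = mult T (A \<otimes> (X \<otimes> Y)) \<cdot> AMap T (AMap T (assoc C A X Y) \<cdot> strength T (A \<otimes> X) Y)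
      \<cdot> rstr (A \<otimes> X) (OMap T Y) \<cdot> (strength T A X \<boxtimes> Id C (OMap T Y))"
    by (simp add: double_strength'_def reassoc[OF mult_nat[symmetric]])
  also have "\<dots> = mult T (A \<otimes> (X \<otimes> Y)) \<cdot> AMap T (strength T A (X \<otimes> Y))
      \<cdot> AMap T (Id C A \<boxtimes> strength T X Y) \<cdot> AMap T (assoc C A X (OMap T Y))
      \<cdot> rstr (A \<otimes> X) (OMap T Y) \<cdot> (strength T A X \<boxtimes> Id C (OMap T Y))"
    by (simp add: strength_assoc)
  also have "\<dots> = strength T A (X \<otimes> Y) \<cdot> (Id C A \<boxtimes> dstr' X Y) \<cdot> assoc C A (OMap T X) (OMap T Y)"
    by (simp add: double_strength'_def bistrength reassoc[OF strength_nat(2)]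
        reassoc[OF strength_mult])
  finally show "AMap T (assoc C A X Y) \<cdot> dstr' (A \<otimes> X) Y \<cdot> (strength T A X \<boxtimes> Id C (OMap T Y))
      = strength T A (X \<otimes> Y) \<cdot> (Id C A \<boxtimes> dstr' X Y) \<cdot> assoc C A (OMap T X) (OMap T Y)" .
qed

text \<open>After composition with the invertible \<open>AMap T (assoc C A X Y)\<close>, the
  required equation is the cone equation of f, whiskered by A and followed by a strength. Hence the
  two sides can be compared there.\<close>

lemma cone_strength:
  assumes f: "cone X (W, f)" and [simp]: "A \<in> Obj C" "X \<in> Obj C"
  shows "cone (A \<otimes> X) (A \<otimes> W, strength T A X \<cdot> (Id C A \<boxtimes> f))"
proof (rule coneI)
  note [simp] = coneD(1-4)[OF f]
  fix Y assume [simp]: "Y \<in> Obj C"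
  let ?k = "strength T A X \<cdot> (Id C A \<boxtimes> f)"
  have "AMap T (assoc C A X Y) \<cdot> (dstr (A \<otimes> X) Y \<cdot> (?k \<boxtimes> Id C (OMap T Y)))
    = (AMap T (assoc C A X Y) \<cdot> dstr (A \<otimes> X) Y \<cdot> (strength T A X \<boxtimes> Id C (OMap T Y)))
      \<cdot> ((Id C A \<boxtimes> f) \<boxtimes> Id C (OMap T Y))"
    by simp
  also have "\<dots> = strength T A (X \<otimes> Y) \<cdot> (Id C A \<boxtimes> (dstr X Y \<cdot> (f \<boxtimes> Id C (OMap T Y))))
      \<cdot> assoc C A W (OMap T Y)"
    by (simp only: double_strength_strength assms \<open>Y \<in> Obj C\<close>) (simp add: assoc_whisker)
  also have "\<dots> = strength T A (X \<otimes> Y) \<cdot> (Id C A \<boxtimes> (dstr' X Y \<cdot> (f \<boxtimes> Id C (OMap T Y))))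
      \<cdot> assoc C A W (OMap T Y)"
    by (simp only: coneD(5)[OF f] \<open>Y \<in> Obj C\<close>)
  also have "\<dots> = (AMap T (assoc C A X Y) \<cdot> dstr' (A \<otimes> X) Y \<cdot> (strength T A X \<boxtimes> Id C (OMap T Y)))
      \<cdot> ((Id C A \<boxtimes> f) \<boxtimes> Id C (OMap T Y))"
    by (simp only: double_strength_strength assms \<open>Y \<in> Obj C\<close>) (simp add: assoc_whisker)
  also have "\<dots> = AMap T (assoc C A X Y) \<cdot> (dstr' (A \<otimes> X) Y \<cdot> (?k \<boxtimes> Id C (OMap T Y)))"
    by simp
  finally show "dstr (A \<otimes> X) Y \<cdot> (?k \<boxtimes> Id C (OMap T Y)) = dstr' (A \<otimes> X) Y \<cdot> (?k \<boxtimes> Id C (OMap T Y))"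
    by (rule AMap_assoc_mono[rotated -1]) simp_all
qed (use coneD[OF f] in simp_all)

text \<open>A cone is tested against \<open>id : T Y \<rightarrow> T Y\<close>, viewed as a Kleisli arrow \<open>T Y \<rightarrow> Y\<close>.\<close>

lemma central_kleisli_arrow_iff_cone:
  assumes [simp]: "X \<in> Obj C"
  shows "central_kleisli_arrow C T (A, f, X) \<longleftrightarrow> cone X (A, f)"
proof
  assume cen: "central_kleisli_arrow C T (A, f, X)"
  then have [simp]: "f \<in> Arr C" "Dom C f = A" "Cod C f = OMap T X" "A \<in> Obj C"
    by (auto simp: central_kleisli_arrow_def kleisli_category_def hom_def)
  show "cone X (A, f)"
  proof (rule coneI)
    fix Y assume [simp]: "Y \<in> Obj C"
    have "(OMap T Y, Id C (OMap T Y), Y) \<in> Arr (kleisli_category C T)"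
      by (simp add: kleisli_category_def hom_def)
    with cen show "dstr X Y \<cdot> (f \<boxtimes> Id C (OMap T Y)) = dstr' X Y \<cdot> (f \<boxtimes> Id C (OMap T Y))"
      by (fastforce simp: central_kleisli_arrow_def double_strength_whisker kleisli_comp_def
          right_whisker_def)
  qed simp_all
next
  assume f: "cone X (A, f)"
  note [simp] = coneD(1-4)[OF f]
  have "kleisli_comp C T (X \<otimes> Y') (right_whisker C T X Y' f') (left_whisker C T X f X')
      = kleisli_comp C T (X \<otimes> Y') (left_whisker C T X f Y') (right_whisker C T A Y' f')"
    if "(X', f', Y') \<in> Arr (kleisli_category C T)" for X' f' Y'
  proof -
    have [simp]: "f' \<in> Arr C" "Dom C f' = X'" "Cod C f' = OMap T Y'" "X' \<in> Obj C" "Y' \<in> Obj C"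
      using that by (auto simp: kleisli_category_def hom_def)
    \<comment> \<open>Interchange pulls f' to the right of f, so the condition for f' is the cone
      condition precomposed with \<open>Id C A \<boxtimes> f'\<close>.\<close>
    have ex: "(Id C (OMap T X) \<boxtimes> f') \<cdot> (f \<boxtimes> Id C X') = (f \<boxtimes> Id C (OMap T Y')) \<cdot> (Id C A \<boxtimes> f')"
      by (simp add: interchange)
    have "kleisli_comp C T (X \<otimes> Y') (right_whisker C T X Y' f') (left_whisker C T X f X')
      = (dstr' X Y' \<cdot> (f \<boxtimes> Id C (OMap T Y'))) \<cdot> (Id C A \<boxtimes> f')"
      by (simp add: kleisli_comp_def right_whisker_def left_whisker_def double_strength'_def
          reassoc[OF right_strength_nat(2)[symmetric]] ex)
    also have "\<dots> = (dstr X Y' \<cdot> (f \<boxtimes> Id C (OMap T Y'))) \<cdot> (Id C A \<boxtimes> f')"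
      using coneD(5)[OF f, of Y'] by simp
    also have "\<dots> = kleisli_comp C T (X \<otimes> Y') (left_whisker C T X f Y') (right_whisker C T A Y' f')"
      by (simp add: kleisli_comp_def right_whisker_def double_strength_whisker)
    finally show ?thesis .
  qed
  then show "central_kleisli_arrow C T (A, f, X)"
    by (auto simp: central_kleisli_arrow_def kleisli_category_def hom_def)
qed

section \<open>Kleisli categories\<close>

lemma Arr_kleisli: "(X, f, Y) \<in> Arr (kleisli_category C T)
    \<longleftrightarrow> f \<in> Arr C \<and> Dom C f = X \<and> Cod C f = OMap T Y \<and> Y \<in> Obj C"
  by (auto simp: kleisli_category_def hom_def)

lemma hom_kleisli: "a \<in> hom (kleisli_category C T) X Y
    \<longleftrightarrow> (\<exists>f. a = (X, f, Y) \<and> f \<in> Arr C \<and> Dom C f = X \<and> Cod C f = OMap T Y \<and> Y \<in> Obj C)"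
  by (auto simp: kleisli_category_def hom_def)

lemma category_kleisli: "category (kleisli_category C T)"
proof
  fix a b c W X Y V
  assume a: "a \<in> hom (kleisli_category C T) W X" and b: "b \<in> hom (kleisli_category C T) X Y"
    and c: "c \<in> hom (kleisli_category C T) Y V"
  obtain f g h where [simp]: "a = (W, f, X)" "b = (X, g, Y)" "c = (Y, h, V)"
    "f \<in> Arr C" "Dom C f = W" "Cod C f = OMap T X" "X \<in> Obj C"
    "g \<in> Arr C" "Dom C g = X" "Cod C g = OMap T Y" "Y \<in> Obj C"
    "h \<in> Arr C" "Dom C h = Y" "Cod C h = OMap T V" "V \<in> Obj C"
    using a b c by (auto simp: hom_kleisli)
  show "(c \<cdot>\<^bsub>kleisli_category C T\<^esub> b) \<cdot>\<^bsub>kleisli_category C T\<^esub> a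
    = c \<cdot>\<^bsub>kleisli_category C T\<^esub> (b \<cdot>\<^bsub>kleisli_category C T\<^esub> a)"
    by (simp add: kleisli_category_def kleisli_comp_def reassoc[OF mult_mult[symmetric]]
        reassoc[OF mult_nat])
next
  fix a X Y
  assume "a \<in> hom (kleisli_category C T) X Y"
  then obtain f where [simp]: "a = (X, f, Y)" "f \<in> Arr C" "Dom C f = X" "Cod C f = OMap T Y"
    "Y \<in> Obj C"
    by (auto simp: hom_kleisli)
  have [simp]: "X \<in> Obj C" using Dom_Obj[of f] by simp
  show "a \<cdot>\<^bsub>kleisli_category C T\<^esub> Id (kleisli_category C T) X = a"
    by (simp add: kleisli_category_def kleisli_comp_def reassoc[OF mult_unit_left]
        flip: unit_nat)
  show "Id (kleisli_category C T) Y \<cdot>\<^bsub>kleisli_category C T\<^esub> a = a"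
    by (simp add: kleisli_category_def kleisli_comp_def reassoc[OF mult_unit_right])
qed (auto simp: hom_kleisli, auto simp: kleisli_category_def kleisli_comp_def hom_def)

text \<open>The predicate \<open>cone X\<close> does not itself require X to be an object, as a
  Kleisli arrow does; hence the extra conjunct.\<close>

lemma Arr_centre: "(A, f, X) \<in> Arr (premonoidal_centre C T) \<longleftrightarrow> X \<in> Obj C \<and> cone X (A, f)"
proof (cases "X \<in> Obj C")
  case False
  then show ?thesis
    by (auto simp: premonoidal_centre_def central_kleisli_arrow_def kleisli_category_def)
qed (simp add: premonoidal_centre_def central_kleisli_arrow_iff_cone)

lemma centre_simps [simp]:
  "Obj (premonoidal_centre C T) = Obj C"
  "Dom (premonoidal_centre C T) = Dom (kleisli_category C T)"
  "Cod (premonoidal_centre C T) = Cod (kleisli_category C T)"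
  "Id (premonoidal_centre C T) = Id (kleisli_category C T)"
  "Comp (premonoidal_centre C T) = Comp (kleisli_category C T)"
  by (simp_all add: premonoidal_centre_def kleisli_category_def)

lemma hom_centre: "a \<in> hom (premonoidal_centre C T) A X
    \<longleftrightarrow> (\<exists>f. a = (A, f, X) \<and> X \<in> Obj C \<and> cone X (A, f))"
  using Arr_centre by (cases a) (auto simp: hom_def kleisli_category_def)

lemma hom_centre_kleisli:
  "a \<in> hom (premonoidal_centre C T) A X \<Longrightarrow> a \<in> hom (kleisli_category C T) A X"
  by (auto simp: hom_centre hom_kleisli dest: coneD)

text \<open>Closure under identities and composition is \<open>cone_unit\<close> and
  \<open>cone_kleisli_comp\<close>; the category laws are inherited from the Kleisli
  category.\<close>

lemma subcategory_centre: "subcategory (premonoidal_centre C T) (kleisli_category C T)"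
proof -
  interpret K: category "kleisli_category C T" by (rule category_kleisli)
  have Arr: "Arr (premonoidal_centre C T) \<subseteq> Arr (kleisli_category C T)"
    using Arr_centre Arr_kleisli by (auto dest: coneD)
  have "category (premonoidal_centre C T)"
  proof
    fix a b X Y V
    assume a: "a \<in> hom (premonoidal_centre C T) X Y" and b: "b \<in> hom (premonoidal_centre C T) Y V"
    then show "b \<cdot>\<^bsub>premonoidal_centre C T\<^esub> a \<in> hom (premonoidal_centre C T) X V"
      by (auto simp: hom_centre, auto simp: kleisli_category_def kleisli_comp_def
          intro: cone_kleisli_comp)
  next
    fix X assume "X \<in> Obj (premonoidal_centre C T)"
    then show "Id (premonoidal_centre C T) X \<in> hom (premonoidal_centre C T) X X"
      by (auto simp: hom_centre, auto simp: kleisli_category_def intro: cone_unit)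
  next
    fix a X Y assume "a \<in> hom (premonoidal_centre C T) X Y"
    then show "a \<cdot>\<^bsub>premonoidal_centre C T\<^esub> Id (premonoidal_centre C T) X = a"
      "Id (premonoidal_centre C T) Y \<cdot>\<^bsub>premonoidal_centre C T\<^esub> a = a"
      by (simp_all add: K.Comp_Id[OF hom_centre_kleisli] K.Id_Comp[OF hom_centre_kleisli])
  next
    fix a b c W X Y V
    assume "a \<in> hom (premonoidal_centre C T) W X" "b \<in> hom (premonoidal_centre C T) X Y"
      "c \<in> hom (premonoidal_centre C T) Y V"
    then show "(c \<cdot>\<^bsub>premonoidal_centre C T\<^esub> b) \<cdot>\<^bsub>premonoidal_centre C T\<^esub> a
      = c \<cdot>\<^bsub>premonoidal_centre C T\<^esub> (b \<cdot>\<^bsub>premonoidal_centre C T\<^esub> a)"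
      using hom_centre_kleisli K.Comp_assoc by (metis centre_simps(5))
  qed (use Arr K.Dom_Obj K.Cod_Obj in \<open>auto simp: kleisli_category_def\<close>)
  then show ?thesis
    using Arr category_kleisli by (auto simp: subcategory_def) (auto simp: kleisli_category_def)
qed

end

section \<open>Morphisms of strong monads\<close>

locale symmetric_strong_monad_morphism =
  symmetric_monoidal_category C + strong_monad_morphism C S T i
  for C :: "('o, 'a) symmoncat" (structure) and S T :: "('o, 'a) strmonad" and i :: "'o \<Rightarrow> 'a"
begin

sublocale S: symmetric_strong_monad C S ..
sublocale T: symmetric_strong_monad C T ..

lemma typing_component [simp]:
  assumes "X \<in> Obj C"
  shows "i X \<in> Arr C" "Dom C (i X) = OMap S X" "Cod C (i X) = OMap T X"
  using homD[OF component_hom[OF assms]] by auto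

lemma component_nat:
  "\<lbrakk>f \<in> Arr C; Dom C f = X; Cod C f = Y\<rbrakk> \<Longrightarrow> i Y \<cdot> AMap S f = AMap T f \<cdot> i X"
  using component_natural arr_hom by metis

lemma component_right_strength:
  assumes [simp]: "X \<in> Obj C" "Y \<in> Obj C"
  shows "i (X \<otimes> Y) \<cdot> right_strength C S X Y = right_strength C T X Y \<cdot> (i X \<boxtimes> Id C Y)"
  by (simp add: right_strength_def reassoc[OF component_nat] reassoc[OF component_strength]
      sym_whisker)

text \<open>The component at X is placed directly after the double strength of T, exactly where a
  cone condition on it can be applied.\<close>

lemma component_double_strength:
  assumes [simp]: "X \<in> Obj C" "Y \<in> Obj C"
  shows "i (X \<otimes> Y) \<cdot> double_strength C S X Y
      = double_strength C T X Y \<cdot> (i X \<boxtimes> Id C (OMap T Y)) \<cdot> (Id C (OMap S X) \<boxtimes> i Y)"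
    "i (X \<otimes> Y) \<cdot> double_strength' C S X Y
      = double_strength' C T X Y \<cdot> (i X \<boxtimes> Id C (OMap T Y)) \<cdot> (Id C (OMap S X) \<boxtimes> i Y)"
proof -
  \<comment> \<open>Pushing the components through \<open>double_strength'\<close> yields them in
    the opposite order.\<close>
  have ex: "(i X \<boxtimes> Id C (OMap T Y)) \<cdot> (Id C (OMap S X) \<boxtimes> i Y)
    = (Id C (OMap T X) \<boxtimes> i Y) \<cdot> (i X \<boxtimes> Id C (OMap S Y))"
    by (simp add: interchange)
  show "i (X \<otimes> Y) \<cdot> double_strength C S X Y
      = double_strength C T X Y \<cdot> (i X \<boxtimes> Id C (OMap T Y)) \<cdot> (Id C (OMap S X) \<boxtimes> i Y)"
    by (simp add: double_strength_def reassoc[OF component_mult] reassoc[OF component_nat]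
        component_strength reassoc[OF T.AMap_eq[OF component_right_strength]]
        reassoc[OF T.strength_nat(1)])
  show "i (X \<otimes> Y) \<cdot> double_strength' C S X Y
      = double_strength' C T X Y \<cdot> (i X \<boxtimes> Id C (OMap T Y)) \<cdot> (Id C (OMap S X) \<boxtimes> i Y)"
    by (simp add: double_strength'_def reassoc[OF component_mult] reassoc[OF component_nat]
        component_right_strength reassoc[OF T.AMap_eq[OF component_strength]] ex
        reassoc[OF T.right_strength_nat(2)])
qed

lemma kleisli_embedding_functor:
  "cat_functor (kleisli_category C S) (kleisli_category C T) (kleisli_embedding C i)"
proof -
  interpret KS: category "kleisli_category C S" by (rule S.category_kleisli)
  interpret KT: category "kleisli_category C T" by (rule T.category_kleisli)
  show ?thesis
  proof
    fix a b X Y V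
    assume "a \<in> hom (kleisli_category C S) X Y" "b \<in> hom (kleisli_category C S) Y V"
    then obtain f g where [simp]: "a = (X, f, Y)" "b = (Y, g, V)"
      "f \<in> Arr C" "Dom C f = X" "Cod C f = OMap S Y" "Y \<in> Obj C"
      "g \<in> Arr C" "Dom C g = Y" "Cod C g = OMap S V" "V \<in> Obj C"
      by (auto simp: S.hom_kleisli)
    show "AMap (kleisli_embedding C i) (b \<cdot>\<^bsub>kleisli_category C S\<^esub> a)
      = AMap (kleisli_embedding C i) b \<cdot>\<^bsub>kleisli_category C T\<^esub> AMap (kleisli_embedding C i) a"
      by (simp add: kleisli_embedding_def kleisli_category_def kleisli_comp_def
          reassoc[OF component_mult] reassoc[OF component_nat])
  qed (auto simp: S.hom_kleisli T.hom_kleisli kleisli_embedding_def, auto simp: kleisli_category_def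
      component_unit)
qed

end

section \<open>The central submonad\<close>

locale terminal_central_cones = symmetric_strong_monad C T
  for C :: "('o, 'a) symmoncat" (structure) and T :: "('o, 'a) strmonad" +
  fixes Z :: "'o \<Rightarrow> 'o" and \<iota> :: "'o \<Rightarrow> 'a"
  assumes terminal: "X \<in> Obj C \<Longrightarrow> terminal_central_cone C T X (Z X, \<iota> X)"
begin

lemma cone_iota: "X \<in> Obj C \<Longrightarrow> cone X (Z X, \<iota> X)"
  using terminal[of X]
  by (simp add: terminal_central_cone_def terminal_object_def central_cone_category_def)

lemma typing_iota [simp]:
  assumes "X \<in> Obj C"
  shows "Z X \<in> Obj C" "\<iota> X \<in> Arr C" "Dom C (\<iota> X) = Z X" "Cod C (\<iota> X) = OMap T X"
  using coneD[OF cone_iota[OF assms]] by auto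

text \<open>Terminality concerns arrows of the cone category, which are triples; this extracts the
  unique factorisation in C.\<close>

lemma cone_lift:
  assumes [simp]: "X \<in> Obj C" and f: "cone X (A, f)"
  shows "\<exists>!\<phi>. \<phi> \<in> hom C A (Z X) \<and> \<iota> X \<cdot> \<phi> = f"
proof -
  have hom: "a \<in> hom (central_cone_category C T X) (A, f) (Z X, \<iota> X) \<longleftrightarrow>
    (\<exists>\<phi>. a = ((A, f), \<phi>, (Z X, \<iota> X)) \<and> \<phi> \<in> hom C A (Z X) \<and> \<iota> X \<cdot> \<phi> = f)" for a
    using f cone_iota[of X] by (auto simp: hom_def central_cone_category_def)
  have "(A, f) \<in> Obj (central_cone_category C T X)"
    using f by (simp add: central_cone_category_def)
  then have "\<exists>!a. a \<in> hom (central_cone_category C T X) (A, f) (Z X, \<iota> X)"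
    using terminal[of X] unfolding terminal_central_cone_def terminal_object_def by simp
  then show ?thesis unfolding hom by (metis prod.inject)
qed

text \<open>By closure under precomposition the common composite is itself a cone, and f and g are
  two factorisations of it.\<close>

lemma iota_mono:
  assumes "\<iota> X \<cdot> f = \<iota> X \<cdot> g" "X \<in> Obj C" "f \<in> Arr C" "g \<in> Arr C"
    "Dom C f = Dom C g" "Cod C f = Z X" "Cod C g = Z X"
  shows "f = g"
proof -
  have "cone X (Dom C f, \<iota> X \<cdot> f)"
    using cone_Comp[OF cone_iota] assms by simp
  from cone_lift[OF assms(2) this] show ?thesis
    using assms by (auto simp: hom_def)
qed

section \<open>The monad structure on Z by factorisation through the cones\<close>

text \<open>The object X is an argument because it cannot be recovered from the codomain T X of
  f.\<close>

definition factor :: "'o \<Rightarrow> 'a \<Rightarrow> 'a" where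
  "factor X f = (THE \<phi>. \<phi> \<in> hom C (Dom C f) (Z X) \<and> \<iota> X \<cdot> \<phi> = f)"

lemma factor:
  assumes "X \<in> Obj C" "cone X (A, f)"
  shows "factor X f \<in> Arr C" "Dom C (factor X f) = A" "Cod C (factor X f) = Z X"
    "\<iota> X \<cdot> factor X f = f"
  using theI'[OF cone_lift[OF assms]] coneD(3)[OF assms(2)] by (auto simp: factor_def hom_def)

text \<open>Each arrow being factored is the T-side of a morphism equation for \<iota>, so these
  equations hold by construction.\<close>

definition central_monad :: "('o, 'a) strmonad" where
  "central_monad =
    \<lparr> OMap = Z,
      AMap = (\<lambda>f. factor (Cod C f) (AMap T f \<cdot> \<iota> (Dom C f))),
      unit = (\<lambda>X. factor X (unit T X)),
      mult = (\<lambda>X. factor X (mult T X \<cdot> AMap T (\<iota> X) \<cdot> \<iota> (Z X))),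
      strength = (\<lambda>X Y. factor (X \<otimes> Y) (strength T X Y \<cdot> (Id C X \<boxtimes> \<iota> Y))) \<rparr>"

abbreviation "M \<equiv> central_monad"

lemma OMap_central [simp]: "OMap M X = Z X"
  by (simp add: central_monad_def)

text \<open>\<open>AMap T f \<cdot> \<iota> (Dom C f)\<close> is a cone as the Kleisli composite of
  \<iota> with the cone \<open>unit T (Cod C f) \<cdot> f\<close>.\<close>

lemma AMap_central [simp]:
  assumes [simp]: "f \<in> Arr C"
  shows "AMap M f \<in> Arr C" "Dom C (AMap M f) = Z (Dom C f)" "Cod C (AMap M f) = Z (Cod C f)"
    and iota_AMap: "Cod C f = Y \<Longrightarrow> \<iota> Y \<cdot> AMap M f = AMap T f \<cdot> \<iota> (Dom C f)"
proof -
  have "cone (Cod C f) (Dom C f, unit T (Cod C f) \<cdot> f)"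
    by (rule cone_Comp[OF cone_unit]) auto
  from cone_kleisli_comp[OF cone_iota this]
  have "cone (Cod C f) (Z (Dom C f), AMap T f \<cdot> \<iota> (Dom C f))"
    by (simp add: reassoc[OF mult_unit_right])
  note factor[OF _ this]
  then show "AMap M f \<in> Arr C" "Dom C (AMap M f) = Z (Dom C f)" "Cod C (AMap M f) = Z (Cod C f)"
    "Cod C f = Y \<Longrightarrow> \<iota> Y \<cdot> AMap M f = AMap T f \<cdot> \<iota> (Dom C f)"
    by (auto simp: central_monad_def)
qed

lemma unit_central [simp]:
  assumes "X \<in> Obj C"
  shows "unit M X \<in> Arr C" "Dom C (unit M X) = X" "Cod C (unit M X) = Z X"
    and iota_unit: "\<iota> X \<cdot> unit M X = unit T X"
  using factor[OF assms cone_unit[OF assms]] by (auto simp: central_monad_def)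

lemma mult_central [simp]:
  assumes "X \<in> Obj C"
  shows "mult M X \<in> Arr C" "Dom C (mult M X) = Z (Z X)" "Cod C (mult M X) = Z X"
    and iota_mult: "\<iota> X \<cdot> mult M X = mult T X \<cdot> AMap T (\<iota> X) \<cdot> \<iota> (Z X)"
  using factor[OF assms cone_kleisli_comp[OF cone_iota cone_iota]] assms
  by (auto simp: central_monad_def)

lemma strength_central [simp]:
  assumes "X \<in> Obj C" "Y \<in> Obj C"
  shows "strength M X Y \<in> Arr C" "Dom C (strength M X Y) = X \<otimes> Z Y"
    "Cod C (strength M X Y) = Z (X \<otimes> Y)"
    and iota_strength: "\<iota> (X \<otimes> Y) \<cdot> strength M X Y = strength T X Y \<cdot> (Id C X \<boxtimes> \<iota> Y)"
  using factor[OF _ cone_strength[OF cone_iota[OF assms(2)] assms]] assms by (auto simp: central_monad_def)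

text \<open>Used after \<open>iota_mono\<close>: they push \<iota> rightwards through the operations
  of \<open>M\<close>, turning a law of \<open>M\<close> into one of \<open>T\<close>.\<close>

lemmas iota_simps = iota_AMap iota_unit iota_mult iota_strength
  reassoc[OF iota_AMap] reassoc[OF iota_unit] reassoc[OF iota_mult] reassoc[OF iota_strength]

lemma strong_monad_central: "strong_monad C M"
proof
  fix f X Y assume "f \<in> hom C X Y"
  note [simp] = homD[OF this]
  have [simp]: "X \<in> Obj C" "Y \<in> Obj C" using Dom_Obj[of f] Cod_Obj[of f] by auto
  show "AMap M f \<in> hom C (OMap M X) (OMap M Y)"
    by (rule homI) simp_all
  show "unit M Y \<cdot> f = AMap M f \<cdot> unit M X"
    by (rule iota_mono[of Y]) (simp_all add: iota_simps unit_nat)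
  show "mult M Y \<cdot> AMap M (AMap M f) = AMap M f \<cdot> mult M X"
    by (rule iota_mono[of Y])
      (simp_all add: iota_simps reassoc[OF AMap_eq[OF iota_AMap]] reassoc[OF mult_nat])
next
  fix f g X Y V assume "f \<in> hom C X Y" "g \<in> hom C Y V"
  note [simp] = homD[OF this(1)] homD[OF this(2)]
  have [simp]: "X \<in> Obj C" "Y \<in> Obj C" "V \<in> Obj C"
    using Dom_Obj[of f] Dom_Obj[of g] Cod_Obj[of g] by auto
  show "AMap M (g \<cdot> f) = AMap M g \<cdot> AMap M f"
    by (rule iota_mono[of V]) (simp_all add: iota_simps)
next
  fix X assume [simp]: "X \<in> Obj C"
  show "OMap M X \<in> Obj C" by simp
  show "unit M X \<in> hom C X (OMap M X)" "mult M X \<in> hom C (OMap M (OMap M X)) (OMap M X)"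
    by (rule homI; simp)+
  show "AMap M (Id C X) = Id C (OMap M X)"
    by (rule iota_mono[of X]) (simp_all add: iota_simps)
  show "mult M X \<cdot> unit M (OMap M X) = Id C (OMap M X)"
    by (rule iota_mono[of X])
      (simp_all add: iota_simps reassoc[OF mult_unit_left] flip: unit_nat)
  show "mult M X \<cdot> AMap M (unit M X) = Id C (OMap M X)"
    by (rule iota_mono[of X])
      (simp_all add: iota_simps reassoc[OF AMap_eq[OF iota_unit]] reassoc[OF mult_unit_right])
  show "mult M X \<cdot> mult M (OMap M X) = mult M X \<cdot> AMap M (mult M X)"
    by (rule iota_mono[of X])
      (simp_all add: iota_simps reassoc[OF AMap_eq[OF iota_mult]] reassoc[OF mult_mult[symmetric]]
        reassoc[OF mult_nat])
  show "AMap M (lunit C X) \<cdot> strength M (Unit C) X = lunit C (OMap M X)"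
    by (rule iota_mono[of X])
      (simp_all add: iota_simps reassoc[OF strength_lunit] lunit_natural[of _ "Z X"] hom_def)
next
  fix X Y assume [simp]: "X \<in> Obj C" "Y \<in> Obj C"
  show "strength M X Y \<in> hom C (X \<otimes> OMap M Y) (OMap M (X \<otimes> Y))"
    by (rule homI) simp_all
  show "strength M X Y \<cdot> (Id C X \<boxtimes> unit M Y) = unit M (X \<otimes> Y)"
    by (rule iota_mono[of "X \<otimes> Y"])
      (simp_all add: iota_simps whisker_eq[OF iota_unit] strength_unit)
  show "strength M X Y \<cdot> (Id C X \<boxtimes> mult M Y)
    = mult M (X \<otimes> Y) \<cdot> AMap M (strength M X Y) \<cdot> strength M X (OMap M Y)"
    by (rule iota_mono[of "X \<otimes> Y"])
      (simp_all add: iota_simps whisker_eq[OF iota_mult] reassoc[OF strength_mult]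
        reassoc[OF AMap_eq[OF iota_strength]] reassoc[OF strength_nat(2)])
next
  fix X Y V assume [simp]: "X \<in> Obj C" "Y \<in> Obj C" "V \<in> Obj C"
  show "AMap M (assoc C X Y V) \<cdot> strength M (X \<otimes> Y) V
    = strength M X (Y \<otimes> V) \<cdot> (Id C X \<boxtimes> strength M Y V) \<cdot> assoc C X Y (OMap M V)"
    by (rule iota_mono[of "X \<otimes> (Y \<otimes> V)"])
      (simp_all add: iota_simps reassoc[OF strength_assoc] assoc_whisker
        reassoc[OF whisker_eq[OF iota_strength]])
next
  fix f g X X' Y Y' assume fg: "f \<in> hom C X X'" "g \<in> hom C Y Y'"
  note [simp] = homD[OF fg(1)] homD[OF fg(2)]
  have [simp]: "X \<in> Obj C" "X' \<in> Obj C" "Y \<in> Obj C" "Y' \<in> Obj C"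
    using Dom_Obj[of f] Dom_Obj[of g] Cod_Obj[of f] Cod_Obj[of g] by auto
  \<comment> \<open>Both tensor factors vary here, so \<iota> is moved across by bifunctoriality
    rather than by a whiskering rule.\<close>
  have "(Id C X' \<boxtimes> \<iota> Y') \<cdot> (f \<boxtimes> AMap M g) = (Id C X' \<cdot> f) \<boxtimes> (\<iota> Y' \<cdot> AMap M g)"
    by (rule tensor_Comp[symmetric]) (simp_all add: hom_def)
  also have "\<dots> = (f \<cdot> Id C X) \<boxtimes> (AMap T g \<cdot> \<iota> Y)"
    by (simp add: iota_simps)
  also have "\<dots> = (f \<boxtimes> AMap T g) \<cdot> (Id C X \<boxtimes> \<iota> Y)"
    by (rule tensor_Comp) (simp_all add: hom_def)
  finally have eq: "(Id C X' \<boxtimes> \<iota> Y') \<cdot> (f \<boxtimes> AMap M g) = (f \<boxtimes> AMap T g) \<cdot> (Id C X \<boxtimes> \<iota> Y)" .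
  show "strength M X' Y' \<cdot> (f \<boxtimes> AMap M g) = AMap M (f \<boxtimes> g) \<cdot> strength M X Y"
    by (rule iota_mono[of "X' \<otimes> Y'"])
      (simp_all add: iota_simps eq reassoc[OF strength_natural[OF fg]])
qed

sublocale iota: symmetric_strong_monad_morphism C M T \<iota>
proof -
  interpret M: strong_monad C M by (rule strong_monad_central)
  show "symmetric_strong_monad_morphism C M T \<iota>"
  proof
    fix f X Y assume "f \<in> hom C X Y"
    then show "\<iota> Y \<cdot> AMap M f = AMap T f \<cdot> \<iota> X"
      using iota_AMap by (auto simp: hom_def)
  qed (simp_all add: hom_def iota_simps)
qed

text \<open>Under \<iota> both double strengths of \<open>M\<close> become those of \<open>T\<close>
  precomposed with \<iota>, where the cone condition identifies them. Monic components make \<iota>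
  left cancellable among morphisms of strong monads.\<close>

lemma commutative_submonad_structure_central: "commutative_submonad_structure C T Z \<iota> M"
proof -
  have "double_strength C M X Y = double_strength' C M X Y"
    if [simp]: "X \<in> Obj C" "Y \<in> Obj C" for X Y
    by (rule iota_mono[of "X \<otimes> Y"])
      (simp_all add: iota.component_double_strength reassoc[OF coneD(5)[OF cone_iota]])
  then have "commutative_strong_monad C M"
    using strong_monad_central symmetric_monoidal_category_axioms
    by (simp add: commutative_strong_monad_def)
  moreover have "strong_monad_monomorphism C M T \<iota>"
    unfolding strong_monad_monomorphism_def
  proof (intro conjI allI impI ballI)
    show "strong_monad_morphism C M T \<iota>" ..
    fix R p q X
    assume h: "strong_monad_morphism C R M p \<and> strong_monad_morphism C R M q \<and>
      (\<forall>X \<in> Obj C. \<iota> X \<cdot> p X = \<iota> X \<cdot> q X)" and [simp]: "X \<in> Obj C"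
    interpret p: strong_monad_morphism C R M p using h by blast
    interpret q: strong_monad_morphism C R M q using h by blast
    show "p X = q X"
      by (rule iota_mono[of X])
        (use h p.component_hom[of X] q.component_hom[of X] in \<open>simp_all add: hom_def\<close>)
  qed
  ultimately show ?thesis by (simp add: commutative_submonad_structure_def)
qed

section \<open>The isomorphism for an arbitrary commutative structure on Z\<close>

lemma corestricts_to_isomorphism_kleisli_embedding:
  assumes N: "commutative_submonad_structure C T Z \<iota> N"
  shows "corestricts_to_isomorphism (kleisli_category C N) (kleisli_category C T)
    (premonoidal_centre C T) (kleisli_embedding C \<iota>)"
proof -
  have OMap_N [simp]: "\<And>X. X \<in> Obj C \<Longrightarrow> OMap N X = Z X"
    using N by (simp add: commutative_submonad_structure_def)
  interpret N: strong_monad_morphism C N T \<iota>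
    using N by (simp add: commutative_submonad_structure_def strong_monad_monomorphism_def)
  interpret N: symmetric_strong_monad_morphism C N T \<iota> ..
  let ?F = "kleisli_embedding C \<iota>"
  interpret F: cat_functor "kleisli_category C N" "kleisli_category C T" ?F
    by (rule N.kleisli_embedding_functor)
  have sub: "subcategory (premonoidal_centre C T) (kleisli_category C T)"
    by (rule subcategory_centre)
  interpret P: category "premonoidal_centre C T"
    using sub by (simp add: subcategory_def)
  \<comment> \<open>The image of a Kleisli arrow of \<open>N\<close> is the cone
    \<open>\<iota> Y\<close> precomposed with an arrow, hence central.\<close>
  have F_hom: "AMap ?F a \<in> hom (premonoidal_centre C T) X Y"
    if a: "a \<in> hom (kleisli_category C N) X Y" for a X Y
    using a by (auto simp: hom_centre N.S.hom_kleisli kleisli_embedding_def intro!: cone_Comp[OF cone_iota])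
  have F: "cat_functor (kleisli_category C N) (premonoidal_centre C T) ?F"
    by unfold_locales
      (use F.OMap_Obj F_hom F.AMap_Id F.AMap_Comp in \<open>simp_all add: kleisli_embedding_def kleisli_category_def\<close>)
  define G :: "('o, 'o \<times> 'a \<times> 'o, 'o, 'o \<times> 'a \<times> 'o) func"
    where "G = \<lparr> OMap = (\<lambda>X. X), AMap = (\<lambda>(X, f, Y). (X, factor Y f, Y)) \<rparr>"
  have G_hom: "AMap G a \<in> hom (kleisli_category C N) X Y"
    and FG: "AMap ?F (AMap G a) = a"
    if "a \<in> hom (premonoidal_centre C T) X Y" for a X Y
    using that by (auto simp: hom_centre N.S.hom_kleisli kleisli_embedding_def G_def factor)
  have F_inj: "a = b" if "AMap ?F a = AMap ?F b" "a \<in> hom (kleisli_category C N) X Y"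
    "b \<in> hom (kleisli_category C N) X Y" for a b X Y
    using that by (auto simp: N.S.hom_kleisli kleisli_embedding_def intro: iota_mono)
  \<comment> \<open>\<open>AMap G a\<close> is the only Kleisli arrow of \<open>N\<close> sent to a.
    To show that \<open>G\<close> preserves an identity or a composite it therefore suffices to
    apply the embedding, which preserves them.\<close>
  have G_eqI: "AMap G a = b" if "a \<in> hom (premonoidal_centre C T) X Y"
    "b \<in> hom (kleisli_category C N) X Y" "AMap ?F b = a" for a b X Y
    using F_inj[OF _ G_hom[OF that(1)] that(2)] FG[OF that(1)] that(3) by simp
  interpret F: cat_functor "kleisli_category C N" "premonoidal_centre C T" ?F by (rule F)
  have G: "cat_functor (premonoidal_centre C T) (kleisli_category C N) G"
  proof
    fix X assume X: "X \<in> Obj (premonoidal_centre C T)"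
    then have X': "X \<in> Obj (kleisli_category C N)" by (simp add: kleisli_category_def)
    then show "OMap G X \<in> Obj (kleisli_category C N)" by (simp add: G_def)
    show "AMap G (Id (premonoidal_centre C T) X) = Id (kleisli_category C N) (OMap G X)"
      using F.AMap_Id[OF X'] F.A.Id_hom[OF X'] P.Id_hom[OF X]
      by (intro G_eqI) (auto simp: G_def kleisli_embedding_def)
  next
    fix a X Y assume "a \<in> hom (premonoidal_centre C T) X Y"
    then show "AMap G a \<in> hom (kleisli_category C N) (OMap G X) (OMap G Y)"
      using G_hom by (simp add: G_def)
  next
    fix a b X Y V
    assume a: "a \<in> hom (premonoidal_centre C T) X Y" and b: "b \<in> hom (premonoidal_centre C T) Y V"
    show "AMap G (b \<cdot>\<^bsub>premonoidal_centre C T\<^esub> a) = AMap G b \<cdot>\<^bsub>kleisli_category C N\<^esub> AMap G a"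
      using F.AMap_Comp[OF G_hom[OF a] G_hom[OF b]] FG[OF a] FG[OF b]
      by (intro G_eqI[OF P.Comp_hom[OF a b] F.A.Comp_hom[OF G_hom[OF a] G_hom[OF b]]]) simp
  qed
  have "isomorphism_of_categories (kleisli_category C N) (premonoidal_centre C T) ?F"
    unfolding isomorphism_of_categories_def
  proof (intro conjI exI[of _ G] ballI)
    fix a assume "a \<in> Arr (kleisli_category C N)"
    from F.A.arr_hom[OF this] show "AMap G (AMap ?F a) = a"
      using F_hom G_eqI by blast
  next
    fix a assume "a \<in> Arr (premonoidal_centre C T)"
    from P.arr_hom[OF this] show "AMap ?F (AMap G a) = a" by (rule FG)
  qed (use F G in \<open>simp_all add: G_def kleisli_embedding_def\<close>)
  then show ?thesis
    using sub N.kleisli_embedding_functor by (simp add: corestricts_to_isomorphism_def)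
qed

end

theorem mainTheorem7:
  fixes C :: "('o, 'a) symmoncat"
    and T :: "('o, 'a) strmonad"
    and Z :: "'o \<Rightarrow> 'o"
    and \<iota> :: "'o \<Rightarrow> 'a"
  assumes "symmetric_monoidal_category C"
    and "strong_monad C T"
    and "centralisable C T"
    and "\<And>X. X \<in> Obj C \<Longrightarrow> terminal_central_cone C T X (Z X, \<iota> X)"
  shows "(\<exists>M. commutative_submonad_structure C T Z \<iota> M) \<and>
    (\<forall>M. commutative_submonad_structure C T Z \<iota> M \<longrightarrow>
      corestricts_to_isomorphism (kleisli_category C M) (kleisli_category C T)
        (premonoidal_centre C T) (kleisli_embedding C \<iota>))"
proof -
  interpret symmetric_monoidal_category C by fact
  interpret strong_monad C T by fact
  interpret terminal_central_cones C T Z \<iota>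
    by unfold_locales (rule assms(4))
  show ?thesis
    using commutative_submonad_structure_central corestricts_to_isomorphism_kleisli_embedding
    by blast
qed

end
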